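(* For $x,y\in[-1,1]$ let $K_2(t,x,y)$ be the function of $t$ given, for $\operatorname{Re}(t)>0$ sufficiently large, by $$K_2(t,x,y)=\frac12+\sum_{n\in\mathbb{N}}\frac{2n+1}{2}P_n(x)P_n(y)e^{-tH_n},$$ where $P_n$ is the $n$th Legendre polynomial and $H_n=\sum_{k=1}^n\frac1k$. Write $\delta_{x,\pm1}=1$ if $x\in\{-1,1\}$ and $\delta_{x,\pm1}=0$ otherwise. Then: (a) For each $x,y\in[-1,1]$ with $x\neq y$, $K_2(t,x,y)$ extends to an entire function of $t$. (b) For each $x\in[-1,1]$, $K_2(t,x,x)$ extends to a meromorphic function of $t\in\mathbb{C}$ with a simple pole at $t=1+\delta_{x,\pm1}$ and additional possible simple poles at $t=-(1+\delta_{x,\pm1})m$, $m\in\mathbb{N}$ (i.e. each of these latter points is either a simple pole or a regular point, and there are no other poles). (c) In particular, $t=0$ is a regular point of $K_2(t,x,y)$ for all $x,y\in[-1,1]$.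
   Context: $\mathbb{N}=\{1,2,\dots\}$. $K_2$ is (the spectral series of) the fundamental solution of $\partial_tu=-A_2u$, where $A_2u(x)=\frac12\int_{-1}^1\frac{u(x)-u(z)}{|x-z|}\,dz$ has eigenpairs $A_2P_n=H_nP_n$, $n\ge0$ (with $H_0=0$). The series converges for $\operatorname{Re}(t)>2$ for all $x,y\in[-1,1]$. *)

theory Defs
  imports "HOL-Complex_Analysis.Complex_Analysis"
begin

(* Bonnet's recursion (n + 2) P_{n+2} = (2 n + 3) X P_{n+1} - (n + 1) P_n,
   i.e. the standard normalisation P_n(1) = 1. *)
fun legendre_poly :: "nat \<Rightarrow> real poly" where
  "legendre_poly 0 = 1"
| "legendre_poly (Suc 0) = [:0, 1:]"
| "legendre_poly (Suc (Suc n)) =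
     smult (1 / (real n + 2))
       (smult (2 * real n + 3) ([:0, 1:] * legendre_poly (Suc n))
        - smult (real n + 1) (legendre_poly n))"

definition K2_term :: "complex \<Rightarrow> real \<Rightarrow> real \<Rightarrow> nat \<Rightarrow> complex" where
  "K2_term t x y n =
     (2 * of_nat n + 1) / 2
       * of_real (poly (legendre_poly n) x) * of_real (poly (legendre_poly n) y)
       * exp (- t * harm n)"

(* The sum over n = 1, 2, ... is written with a shifted index. The value is only
   meaningful where the series converges. *)
definition K2_series :: "complex \<Rightarrow> real \<Rightarrow> real \<Rightarrow> complex" where
  "K2_series t x y = 1 / 2 + (\<Sum>n. K2_term t x y (Suc n))"

definition endpoint_delta :: "real \<Rightarrow> nat" where
  "endpoint_delta x = (if x \<in> {-1, 1} then 1 else 0)"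

definition has_simple_pole :: "(complex \<Rightarrow> complex) \<Rightarrow> complex \<Rightarrow> bool" where
  "has_simple_pole f z \<longleftrightarrow> isolated_singularity_at f z \<and> is_pole f z \<and> zorder f z = -1"

end

theory Submission
  imports Defs
begin

text \<open>
The proof is summation by parts, repeated until the series converges as far to the left as desired.
After a shift of the index the \<open>n\<close>-th term of the series is \<open>(n + 3/2) P\<^sub>n\<^sub>+\<^sub>1(x) P\<^sub>n\<^sub>+\<^sub>1(y) W\<^sub>n(t)\<close> with
\<open>W\<^sub>n(t) = exp (- t H\<^sub>n\<^sub>+\<^sub>1)\<close>. Put \<open>z = 1 / (n + 2)\<close>. Two facts drive everything:
\<open>W\<^sub>n\<^sub>+\<^sub>1 = W\<^sub>n exp (- t z)\<close> exactly, and by Bonnet's recursion the vector of the four products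
\<open>P\<^sub>i(x) P\<^sub>j(y)\<close> with \<open>i, j \<in> {n, n + 1}\<close> is mapped to the next one by a matrix that is polynomial in \<open>z\<close>.
So if \<open>M\<close> is the value of that matrix at \<open>z = 0\<close> and \<open>X\<close> is the vector, telescoping the sequence
\<open>(n + 2) z\<^sup>k W\<^sub>n X\<close> shows that the series of \<open>(n + 2) z\<^sup>k W\<^sub>n (M - 1) X\<close> is an entire function plus series of the
same kind with \<open>k + 1\<close> in place of \<open>k\<close>. Once \<open>k\<close> is large, the series converges in a prescribed half
plane. All coefficients that arise have expansions in powers of \<open>z\<close> with entire functions of \<open>t\<close>
as coefficients (\<open>expandable\<close>).

Off the diagonal \<open>M - 1\<close> is invertible, its determinant being a multiple of \<open>(x - y)\<^sup>2\<close>, and the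
continuation is entire (\<open>continues_offdiagonal\<close>).

On the diagonal with \<open>\<bar>x\<bar> < 1\<close> one quadratic form in \<open>P\<^sub>n\<^sub>+\<^sub>1\<close> and \<open>P\<^sub>n\<close> escapes, namely
\<open>Q\<^sub>n = P\<^sub>n\<^sub>+\<^sub>1\<^sup>2 - 2 x P\<^sub>n\<^sub>+\<^sub>1 P\<^sub>n + P\<^sub>n\<^sup>2\<close>, which satisfies the exact law
\<open>(n + 2)\<^sup>2 Q\<^sub>n\<^sub>+\<^sub>1 - (n + 1)\<^sup>2 Q\<^sub>n = (1 - x\<^sup>2) (2 n + 3) P\<^sub>n\<^sub>+\<^sub>1\<^sup>2\<close> (the confluent Christoffel-Darboux formula).
Telescoping \<open>(n + 1)\<^sup>2 Q\<^sub>n\<close> against the weight now produces the series with a factor \<open>t - (1 - k)\<close> in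
front, and dividing by it costs one simple pole (\<open>diagonal_step\<close>). At \<open>x = \<plusminus> 1\<close>, where \<open>P\<^sub>n\<^sup>2 = 1\<close>, a
telescope centred at the midpoints \<open>n + 3/2\<close> makes all expansions even in \<open>z\<close>, so that
poles appear only at every second integer (\<open>endpoint_step\<close>). In both cases a first summation by
parts writes the series as an entire function plus \<open>t\<close> times a series of the same kind, and the
factor \<open>t\<close> removes the possible pole at \<open>0\<close> (\<open>K2_term_summation_by_parts\<close>).

The pole at \<open>t = 1\<close>, respectively \<open>t = 2\<close>, is really there because the series has nonnegative terms
and diverges at that point (\<open>not_analytic_of_divergence\<close>); for \<open>\<bar>x\<bar> < 1\<close> this needs that \<open>n Q\<^sub>n\<close> stays between
positive constants (\<open>legendre_form_asymptotics\<close>). The continuations to the half planes \<open>Re t > - N\<close>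
are finally glued by the identity theorem (\<open>glue_continuations\<close>).
\<close>

section \<open>Expansions in powers of a small step\<close>

text \<open>
Both signs are admitted although the steps that occur are positive: evenness in \<open>z\<close> is what
suppresses half of the poles at the end points, and it can only be expressed on a symmetric set.
\<close>
definition small_steps :: "real set" where
  "small_steps = {z. z \<noteq> 0 \<and> \<bar>z\<bar> \<le> 1 / 2}"

definition bounded_family :: "(real \<Rightarrow> complex \<Rightarrow> complex) \<Rightarrow> bool" where
  "bounded_family F \<longleftrightarrow>
     (\<forall>z\<in>small_steps. F z holomorphic_on UNIV) \<and>
     (\<forall>R. \<exists>C\<ge>0. \<forall>z\<in>small_steps. \<forall>t. norm t \<le> R \<longrightarrow> norm (F z t) \<le> C)"

text \<open>
A family with an asymptotic expansion to order \<open>d\<close> in \<open>z\<close>, whose coefficients are entire functions of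
\<open>t\<close> and whose remainder is bounded for \<open>t\<close> in bounded sets. The nested form, peeling off one coefficient at a
time, is the one in which a single summation by parts consumes it.
\<close>
primrec expandable :: "nat \<Rightarrow> (real \<Rightarrow> complex \<Rightarrow> complex) \<Rightarrow> bool" where
  "expandable 0 F \<longleftrightarrow> bounded_family F"
| "expandable (Suc d) F \<longleftrightarrow>
     (\<exists>a G. a holomorphic_on UNIV \<and> expandable d G \<and>
        (\<forall>z\<in>small_steps. \<forall>t. F z t = a t + of_real z * G z t))"

lemma small_steps_nonempty: "1 / 2 \<in> small_steps"
  by (simp add: small_steps_def)

lemma bounded_family_holomorphic:
  "bounded_family F \<Longrightarrow> z \<in> small_steps \<Longrightarrow> F z holomorphic_on UNIV"
  by (simp add: bounded_family_def)

lemma bounded_family_bound: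
  assumes "bounded_family F"
  obtains C where "C \<ge> 0" "\<And>z t. z \<in> small_steps \<Longrightarrow> norm t \<le> R \<Longrightarrow> norm (F z t) \<le> C"
  using assms unfolding bounded_family_def by meson

lemma bounded_familyI:
  assumes "\<And>z. z \<in> small_steps \<Longrightarrow> F z holomorphic_on UNIV"
    and "\<And>R. \<exists>C. \<forall>z\<in>small_steps. \<forall>t. norm t \<le> R \<longrightarrow> norm (F z t) \<le> C"
  shows "bounded_family F"
  unfolding bounded_family_def
proof (intro conjI ballI allI)
  fix R
  obtain C where "\<forall>z\<in>small_steps. \<forall>t. norm t \<le> R \<longrightarrow> norm (F z t) \<le> C"
    using assms(2) by blast
  then show "\<exists>C\<ge>0. \<forall>z\<in>small_steps. \<forall>t. norm t \<le> R \<longrightarrow> norm (F z t) \<le> C"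
    by (intro exI[of _ "max C 0"]) (auto intro: le_max_iff_disj[THEN iffD2])
qed (use assms in auto)

lemma bounded_family_cong:
  assumes "\<And>z t. z \<in> small_steps \<Longrightarrow> F z t = G z t"
  shows "bounded_family F \<longleftrightarrow> bounded_family G"
proof -
  have "F z = G z" if "z \<in> small_steps" for z
    using assms[OF that] by auto
  then show ?thesis by (simp add: bounded_family_def)
qed

lemma bounded_family_add:
  assumes "bounded_family F" "bounded_family G"
  shows "bounded_family (\<lambda>z t. F z t + G z t)"
proof (rule bounded_familyI)
  fix R
  obtain C1 where "\<And>z t. z \<in> small_steps \<Longrightarrow> norm t \<le> R \<Longrightarrow> norm (F z t) \<le> C1"
    using bounded_family_bound[OF assms(1)] by metis
  moreover obtain C2 where "\<And>z t. z \<in> small_steps \<Longrightarrow> norm t \<le> R \<Longrightarrow> norm (G z t) \<le> C2"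
    using bounded_family_bound[OF assms(2)] by metis
  ultimately show "\<exists>C. \<forall>z\<in>small_steps. \<forall>t. norm t \<le> R \<longrightarrow> norm (F z t + G z t) \<le> C"
    by (intro exI[of _ "C1 + C2"]) (auto intro: norm_triangle_mono)
qed (intro holomorphic_intros bounded_family_holomorphic assms)

lemma bounded_family_mult:
  assumes "bounded_family F" "bounded_family G"
  shows "bounded_family (\<lambda>z t. F z t * G z t)"
proof (rule bounded_familyI)
  fix R
  obtain C1 where "C1 \<ge> 0" "\<And>z t. z \<in> small_steps \<Longrightarrow> norm t \<le> R \<Longrightarrow> norm (F z t) \<le> C1"
    using bounded_family_bound[OF assms(1)] by metis
  moreover obtain C2 where "C2 \<ge> 0" "\<And>z t. z \<in> small_steps \<Longrightarrow> norm t \<le> R \<Longrightarrow> norm (G z t) \<le> C2"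
    using bounded_family_bound[OF assms(2)] by metis
  ultimately show "\<exists>C. \<forall>z\<in>small_steps. \<forall>t. norm t \<le> R \<longrightarrow> norm (F z t * G z t) \<le> C"
    by (intro exI[of _ "C1 * C2"]) (auto simp: norm_mult intro: mult_mono)
qed (intro holomorphic_intros bounded_family_holomorphic assms)

lemma bounded_family_const:
  assumes "a holomorphic_on UNIV"
  shows "bounded_family (\<lambda>_. a)"
proof (rule bounded_familyI)
  fix R
  have "compact (a ` cball 0 R)"
    by (intro compact_continuous_image holomorphic_on_imp_continuous_on)
       (use assms holomorphic_on_subset in auto)
  then have "bounded (a ` cball 0 R)" by (rule compact_imp_bounded)
  then obtain C where "\<forall>t. norm t \<le> R \<longrightarrow> norm (a t) \<le> C"
    unfolding bounded_iff by fastforce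
  then show "\<exists>C. \<forall>z\<in>small_steps. \<forall>t. norm t \<le> R \<longrightarrow> norm (a t) \<le> C"
    by blast
qed (rule assms)

lemma bounded_family_step: "bounded_family (\<lambda>z _. of_real z)"
  by (rule bounded_familyI) (auto simp: small_steps_def intro!: exI[of _ "1 / 2"])

lemma expandable_imp_bounded: "expandable d F \<Longrightarrow> bounded_family F"
proof (induction d arbitrary: F)
  case (Suc d)
  then obtain a G where *: "a holomorphic_on UNIV" "expandable d G"
      "\<And>z t. z \<in> small_steps \<Longrightarrow> F z t = a t + of_real z * G z t"
    by auto
  have "bounded_family (\<lambda>z t. a t + of_real z * G z t)"
    by (intro bounded_family_add bounded_family_mult bounded_family_const bounded_family_step
        * Suc.IH)
  then show ?case
    using bounded_family_cong[of F "\<lambda>z t. a t + of_real z * G z t"] *(3) by simp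
qed auto

lemma expandable_SucI:
  assumes "a holomorphic_on UNIV" "expandable d G"
    "\<And>z t. z \<in> small_steps \<Longrightarrow> F z t = a t + of_real z * G z t"
  shows "expandable (Suc d) F"
  using assms by auto

lemma expandable_mono_Suc: "expandable (Suc d) F \<Longrightarrow> expandable d F"
proof (induction d arbitrary: F)
  case 0
  then show ?case using expandable_imp_bounded[OF 0] by simp
next
  case (Suc d)
  then obtain a G where "a holomorphic_on UNIV" "expandable (Suc d) G"
      "\<And>z t. z \<in> small_steps \<Longrightarrow> F z t = a t + of_real z * G z t"
    by (metis expandable.simps(2))
  with Suc.IH show ?case by (intro expandable_SucI) auto
qed

lemma expandable_cong:
  assumes "expandable d F" "\<And>z t. z \<in> small_steps \<Longrightarrow> F z t = G z t"
  shows "expandable d G"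
proof (cases d)
  case 0
  then show ?thesis using assms bounded_family_cong[of F G] by simp
next
  case (Suc d')
  with assms(1) obtain a H where "a holomorphic_on UNIV" "expandable d' H"
      "\<And>z t. z \<in> small_steps \<Longrightarrow> F z t = a t + of_real z * H z t"
    by auto
  with Suc assms(2) show ?thesis
    by (metis expandable_SucI)
qed

lemma expandable_const: "a holomorphic_on UNIV \<Longrightarrow> expandable d (\<lambda>_. a)"
proof (induction d arbitrary: a)
  case (Suc d)
  then show ?case
    by (intro expandable_SucI[where a = a and G = "\<lambda>_ _. 0"]) auto
qed (auto intro: bounded_family_const)

lemma expandable_add:
  "expandable d F \<Longrightarrow> expandable d G \<Longrightarrow> expandable d (\<lambda>z t. F z t + G z t)"
proof (induction d arbitrary: F G)
  case (Suc d)
  obtain a F' where F: "a holomorphic_on UNIV" "expandable d F'"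
      "\<And>z t. z \<in> small_steps \<Longrightarrow> F z t = a t + of_real z * F' z t"
    using Suc.prems(1) by auto
  obtain b G' where G: "b holomorphic_on UNIV" "expandable d G'"
      "\<And>z t. z \<in> small_steps \<Longrightarrow> G z t = b t + of_real z * G' z t"
    using Suc.prems(2) by auto
  show ?case
    by (rule expandable_SucI[where a = "\<lambda>t. a t + b t" and G = "\<lambda>z t. F' z t + G' z t"])
       (auto simp: F G algebra_simps intro!: holomorphic_intros Suc.IH)
qed (auto intro: bounded_family_add)

lemma expandable_step: "expandable d F \<Longrightarrow> expandable d (\<lambda>z t. of_real z * F z t)"
  by (rule expandable_mono_Suc, rule expandable_SucI[where a = "\<lambda>_. 0"]) auto

lemma expandable_mult:
  "expandable d F \<Longrightarrow> expandable d G \<Longrightarrow> expandable d (\<lambda>z t. F z t * G z t)"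
proof (induction d arbitrary: F G)
  case (Suc d)
  obtain a F' where F: "a holomorphic_on UNIV" "expandable d F'"
      "\<And>z t. z \<in> small_steps \<Longrightarrow> F z t = a t + of_real z * F' z t"
    using Suc.prems(1) by auto
  obtain b G' where G: "b holomorphic_on UNIV" "expandable d G'"
      "\<And>z t. z \<in> small_steps \<Longrightarrow> G z t = b t + of_real z * G' z t"
    using Suc.prems(2) by auto
  show ?case
    by (rule expandable_SucI[where a = "\<lambda>t. a t * b t" and
             G = "\<lambda>z t. a t * G' z t + F' z t * b t + of_real z * (F' z t * G' z t)"])
       (auto simp: F G algebra_simps intro!: holomorphic_intros
          Suc.IH expandable_add expandable_step expandable_const)
qed (auto intro: bounded_family_mult)

lemma expandable_id: "expandable d (\<lambda>z _. of_real z)"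
  using expandable_step[OF expandable_const[of "\<lambda>_. 1"]] by simp

lemma expandable_uminus: "expandable d F \<Longrightarrow> expandable d (\<lambda>z t. - F z t)"
  using expandable_mult[OF expandable_const[of "\<lambda>_. -1"], of d F] by simp

lemma expandable_diff:
  "expandable d F \<Longrightarrow> expandable d G \<Longrightarrow> expandable d (\<lambda>z t. F z t - G z t)"
  using expandable_add[OF _ expandable_uminus, of d F G] by simp

lemma expandable_power: "expandable d F \<Longrightarrow> expandable d (\<lambda>z t. F z t ^ k)"
  by (induction k) (auto intro: expandable_mult expandable_const)

lemma minus_mem_small_steps [simp]: "- z \<in> small_steps \<longleftrightarrow> z \<in> small_steps"
  by (simp add: small_steps_def)

lemma expandable_reflect: "expandable d F \<Longrightarrow> expandable d (\<lambda>z. F (- z))"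
proof (induction d arbitrary: F)
  case 0
  then have F: "bounded_family F" by simp
  have "\<exists>C. \<forall>z\<in>small_steps. \<forall>t. norm t \<le> R \<longrightarrow> norm (F (- z) t) \<le> C" for R
    using bounded_family_bound[OF F, of R] by (metis minus_mem_small_steps)
  moreover have "F (- z) holomorphic_on UNIV" if "z \<in> small_steps" for z
    using bounded_family_holomorphic[OF F, of "- z"] that by simp
  ultimately show ?case by (simp add: bounded_familyI)
next
  case (Suc d)
  then obtain a G where *: "a holomorphic_on UNIV" "expandable d G"
      "\<And>z t. z \<in> small_steps \<Longrightarrow> F z t = a t + of_real z * G z t"
    by auto
  have "expandable d (\<lambda>z t. - G (- z) t)"
    by (intro expandable_uminus Suc.IH *)
  then show ?case
    by (rule expandable_SucI[OF *(1)]) (simp add: *(3))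
qed

lemma expandable_inverse_one_plus:
  assumes "\<bar>c\<bar> \<le> 1"
  shows "expandable d (\<lambda>z _. inverse (1 + of_real (c * z)))"
proof (induction d)
  have half: "norm (1 + complex_of_real (c * z)) \<ge> 1 / 2" if "z \<in> small_steps" for z
  proof -
    have "\<bar>c * z\<bar> \<le> 1 / 2"
      using that assms mult_mono[of "\<bar>c\<bar>" 1 "\<bar>z\<bar>" "1/2"] by (auto simp: abs_mult small_steps_def)
    then have "\<bar>1 + c * z\<bar> \<ge> 1 / 2" by linarith
    then show ?thesis by (metis norm_of_real of_real_1 of_real_add)
  qed
  {
    case 0
    have "norm (inverse (1 + complex_of_real (c * z))) \<le> 2" if "z \<in> small_steps" for z
      using le_imp_inverse_le[OF half[OF that]] by (simp add: norm_inverse)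
    then show ?case
      by (auto intro!: bounded_familyI exI[of _ 2])
  next
    case (Suc d)
    have "inverse (1 + of_real (c * z)) =
            1 + of_real z * (- of_real c * inverse (1 + complex_of_real (c * z)))"
      if "z \<in> small_steps" for z
    proof -
      have "1 + complex_of_real (c * z) \<noteq> 0" using half[OF that] by auto
      then show ?thesis by (simp add: field_simps)
    qed
    then show ?case
      by (intro expandable_SucI[where a = "\<lambda>_. 1"
            and G = "\<lambda>z _. - of_real c * inverse (1 + of_real (c * z))"]
          expandable_mult Suc expandable_const holomorphic_intros)
  }
qed

text \<open>
The removable singularity of a difference quotient. Iterated, it yields the Taylor expansion of \<open>h (c z t)\<close>
in \<open>z\<close> with remainders that are again of this form.
\<close>
lemma entire_factor:
  fixes h :: "complex \<Rightarrow> complex"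
  assumes "h holomorphic_on UNIV"
  obtains h1 where "h1 holomorphic_on UNIV" "\<And>w. h w = h 0 + w * h1 w" "h1 0 = deriv h 0"
proof
  let ?h1 = "\<lambda>w. if w = 0 then deriv h 0 else (h w - h 0) / w"
  show "?h1 holomorphic_on UNIV"
    using pole_lemma_open[OF assms open_UNIV, of 0] unfolding diff_zero .
qed auto

lemma expandable_entire:
  "h holomorphic_on UNIV \<Longrightarrow> expandable d (\<lambda>z t. h (of_real (c * z) * t))"
proof (induction d arbitrary: h)
  case 0
  have "\<exists>C. \<forall>z\<in>small_steps. \<forall>t. norm t \<le> R \<longrightarrow> norm (h (of_real (c * z) * t)) \<le> C" for R
  proof -
    obtain C where C: "\<And>w. norm w \<le> \<bar>c\<bar> * R \<Longrightarrow> norm (h w) \<le> C"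
      using bounded_family_bound[OF bounded_family_const[OF 0], of "\<bar>c\<bar> * R"] small_steps_nonempty
      by metis
    have "norm (of_real (c * z) * t) \<le> \<bar>c\<bar> * R" if "z \<in> small_steps" "norm t \<le> R" for z and t :: complex
    proof -
      have "\<bar>z\<bar> * norm t \<le> 1 * R"
        using that by (intro mult_mono) (auto simp: small_steps_def)
      then show ?thesis by (simp add: norm_mult abs_mult mult.assoc mult_left_mono)
    qed
    with C show ?thesis by blast
  qed
  moreover have "(\<lambda>t. h (of_real (c * z) * t)) holomorphic_on UNIV" for z
    by (rule holomorphic_on_compose_gen[OF _ 0, unfolded o_def]) (auto intro!: holomorphic_intros)
  ultimately show ?case by (simp add: bounded_familyI)
next
  case (Suc d)
  obtain h1 where h1: "h1 holomorphic_on UNIV" "\<And>w. h w = h 0 + w * h1 w"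
    using entire_factor[OF Suc.prems] by metis
  have "expandable d (\<lambda>z t. of_real c * t * h1 (of_real (c * z) * t))"
    by (intro expandable_mult[OF expandable_const] Suc.IH h1 holomorphic_intros)
  then show ?case
  proof (rule expandable_SucI[rotated])
    show "(\<lambda>_. h 0) holomorphic_on UNIV" by simp
  next
    fix z t
    show "h (of_real (c * z) * t) = h 0 + of_real z * (of_real c * t * h1 (of_real (c * z) * t))"
      by (subst h1(2)) simp
  qed
qed

lemma expandable_exp: "expandable d (\<lambda>z t. exp (of_real (c * z) * t))"
  by (intro expandable_entire holomorphic_intros)

lemmas expandable_intros =
  expandable_add expandable_mult expandable_diff expandable_uminus
  expandable_power expandable_const expandable_id expandable_inverse_one_plus

text \<open>
The coefficients of order \<open>0\<close> and \<open>1\<close> have to be known explicitly: the second one decides where the poles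
lie.
\<close>
definition two_term_expansion :: "(real \<Rightarrow> complex \<Rightarrow> complex) \<Rightarrow> (complex \<Rightarrow> complex) \<Rightarrow> (complex \<Rightarrow> complex) \<Rightarrow> bool" where
  "two_term_expansion F a b \<longleftrightarrow> a holomorphic_on UNIV \<and> b holomorphic_on UNIV \<and>
     (\<exists>H. (\<forall>d. expandable d H) \<and>
       (\<forall>z\<in>small_steps. \<forall>t. F z t = a t + of_real z * b t + of_real z ^ 2 * H z t))"

lemma two_term_expansionD:
  assumes "two_term_expansion F a b"
  obtains H where "\<And>d. expandable d H"
    "\<And>z t. z \<in> small_steps \<Longrightarrow> F z t = a t + of_real z * b t + of_real z ^ 2 * H z t"
  using assms unfolding two_term_expansion_def by blast

lemma two_term_expansion_mult:
  assumes F: "two_term_expansion F a b" and G: "two_term_expansion G c e"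
  shows "two_term_expansion (\<lambda>z t. F z t * G z t) (\<lambda>t. a t * c t) (\<lambda>t. a t * e t + b t * c t)"
proof -
  obtain H where H: "\<And>d. expandable d H"
      "\<And>z t. z \<in> small_steps \<Longrightarrow> F z t = a t + of_real z * b t + of_real z ^ 2 * H z t"
    using two_term_expansionD[OF F] by blast
  obtain I where I: "\<And>d. expandable d I"
      "\<And>z t. z \<in> small_steps \<Longrightarrow> G z t = c t + of_real z * e t + of_real z ^ 2 * I z t"
    using two_term_expansionD[OF G] by blast
  have hol: "a holomorphic_on UNIV" "b holomorphic_on UNIV" "c holomorphic_on UNIV" "e holomorphic_on UNIV"
    using F G by (auto simp: two_term_expansion_def)
  show ?thesis
    unfolding two_term_expansion_def
  proof (intro conjI exI allI ballI)
    show "expandable d (\<lambda>z t. a t * I z t + H z t * c t + b t * e t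
            + of_real z * (b t * I z t + H z t * e t) + of_real z ^ 2 * (H z t * I z t))" for d
      by (intro expandable_intros H I hol)
  qed (auto simp: H I algebra_simps power2_eq_square intro!: holomorphic_intros hol)
qed

lemma two_term_expansion_exp:
  "two_term_expansion (\<lambda>z t. exp (of_real (c * z) * t)) (\<lambda>_. 1) (\<lambda>t. of_real c * t)"
proof -
  have exp: "exp holomorphic_on (UNIV :: complex set)" by (intro holomorphic_intros)
  obtain h1 where h1: "h1 holomorphic_on UNIV" "\<And>w. exp w = exp 0 + w * h1 w"
      "h1 0 = deriv exp (0 :: complex)"
    using entire_factor[OF exp] by metis
  obtain h2 where h2: "h2 holomorphic_on UNIV" "\<And>w. h1 w = h1 0 + w * h2 w"
    using entire_factor[OF h1(1)] by metis
  have "deriv exp (0 :: complex) = 1" by (rule DERIV_imp_deriv) (use DERIV_exp[of "0 :: complex"] in simp)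
  then have exp_eq: "exp w = 1 + w + w ^ 2 * h2 w" for w
    using h1(2)[of w] h1(3) h2(2)[of w] by (simp add: algebra_simps power2_eq_square)
  show ?thesis
    unfolding two_term_expansion_def
  proof (intro conjI exI allI ballI)
    show "expandable d (\<lambda>z t. (of_real c * t) ^ 2 * h2 (of_real (c * z) * t))" for d
      by (intro expandable_mult expandable_const expandable_entire h2 holomorphic_intros)
  qed (auto simp: exp_eq power2_eq_square intro!: holomorphic_intros)
qed

lemma two_term_expansion_one_plus: "two_term_expansion (\<lambda>z _. 1 + of_real (c * z)) (\<lambda>_. 1) (\<lambda>_. of_real c)"
  unfolding two_term_expansion_def
  by (intro conjI exI[of _ "\<lambda>_ _. 0"]) (auto intro: expandable_const)

lemma two_term_expansion_inverse_one_plus: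
  assumes "\<bar>c\<bar> \<le> 1"
  shows "two_term_expansion (\<lambda>z _. inverse (1 + of_real (c * z))) (\<lambda>_. 1) (\<lambda>_. - of_real c)"
  unfolding two_term_expansion_def
proof (intro conjI exI allI ballI)
  show "expandable d (\<lambda>z _. of_real c ^ 2 * inverse (1 + of_real (c * z)))" for d
    by (intro expandable_intros assms) auto
next
  fix z and t :: complex assume z: "z \<in> small_steps"
  have "\<bar>c * z\<bar> \<le> 1 / 2"
    using z assms mult_mono[of "\<bar>c\<bar>" 1 "\<bar>z\<bar>" "1/2"] by (auto simp: abs_mult small_steps_def)
  then have "1 + c * z \<noteq> 0" by linarith
  then have "1 + complex_of_real (c * z) \<noteq> 0" by (metis of_real_1 of_real_add of_real_eq_0_iff)
  then show "inverse (1 + complex_of_real (c * z)) = 1 + complex_of_real z * - complex_of_real c +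
       (of_real z)\<^sup>2 * ((of_real c)\<^sup>2 * inverse (1 + of_real (c * z)))"
    by (simp add: field_simps power2_eq_square)
qed auto

lemma two_term_expansion_power:
  assumes "two_term_expansion F (\<lambda>_. 1) b"
  shows "two_term_expansion (\<lambda>z t. F z t ^ k) (\<lambda>_. 1) (\<lambda>t. of_nat k * b t)"
proof (induction k)
  case 0
  show ?case unfolding two_term_expansion_def
    by (intro conjI exI[of _ "\<lambda>_ _. 0"]) (auto intro: expandable_const)
next
  case (Suc k)
  from two_term_expansion_mult[OF assms this] show ?case by (simp add: algebra_simps)
qed


section \<open>Continuation of series up to finitely many simple poles\<close>

text \<open>
At most simple poles are allowed, all in \<open>P\<close>. Multiplying by the linear factors keeps the continuation holomorphic, so
that it can be added and scaled without any bookkeeping of singularities.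
\<close>
definition continues :: "complex set \<Rightarrow> nat \<Rightarrow> (nat \<Rightarrow> complex \<Rightarrow> complex) \<Rightarrow> bool" where
  "continues P N f \<longleftrightarrow>
     (\<forall>t. Re t > 2 \<longrightarrow> summable (\<lambda>n. f n t)) \<and>
     (\<exists>g. g holomorphic_on {t. Re t > - real N} \<and>
        (\<forall>t. Re t > 2 \<longrightarrow> (\<Prod>s\<in>P. t - s) * (\<Sum>n. f n t) = g t))"

lemma continues_summable: "continues P N f \<Longrightarrow> Re t > 2 \<Longrightarrow> summable (\<lambda>n. f n t)"
  by (simp add: continues_def)

lemma continues_cong:
  assumes "continues P N f" "\<And>n t. Re t > 2 \<Longrightarrow> f n t = g n t"
  shows "continues P N g"
proof -
  have "(\<lambda>n. f n t) = (\<lambda>n. g n t)" if "Re t > 2" for t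
    using assms(2)[OF that] by auto
  then show ?thesis using assms(1) by (simp add: continues_def)
qed

lemma continues_add:
  assumes "continues P N f" "continues P N g"
  shows "continues P N (\<lambda>n t. f n t + g n t)"
proof -
  obtain F where F: "F holomorphic_on {t. Re t > - real N}"
      "\<And>t. Re t > 2 \<Longrightarrow> (\<Prod>s\<in>P. t - s) * (\<Sum>n. f n t) = F t"
    using assms(1) by (auto simp: continues_def)
  obtain G where G: "G holomorphic_on {t. Re t > - real N}"
      "\<And>t. Re t > 2 \<Longrightarrow> (\<Prod>s\<in>P. t - s) * (\<Sum>n. g n t) = G t"
    using assms(2) by (auto simp: continues_def)
  show ?thesis
    unfolding continues_def
  proof (intro conjI exI[of _ "\<lambda>t. F t + G t"] allI impI)
    fix t :: complex assume t: "Re t > 2"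
    show "(\<Prod>s\<in>P. t - s) * (\<Sum>n. f n t + g n t) = F t + G t"
      using suminf_add[OF assms[THEN continues_summable, OF t], symmetric] F(2)[OF t] G(2)[OF t]
      by (simp add: algebra_simps)
  qed (auto intro!: holomorphic_intros F G summable_add assms[THEN continues_summable])
qed

lemma continues_mult:
  assumes "continues P N f" "a holomorphic_on UNIV"
  shows "continues P N (\<lambda>n t. a t * f n t)"
proof -
  obtain F where F: "F holomorphic_on {t. Re t > - real N}"
      "\<And>t. Re t > 2 \<Longrightarrow> (\<Prod>s\<in>P. t - s) * (\<Sum>n. f n t) = F t"
    using assms(1) by (auto simp: continues_def)
  show ?thesis
    unfolding continues_def
  proof (intro conjI exI[of _ "\<lambda>t. a t * F t"] allI impI)
    fix t :: complex assume t: "Re t > 2"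
    show "(\<Prod>s\<in>P. t - s) * (\<Sum>n. a t * f n t) = a t * F t"
      using suminf_mult[OF assms(1)[THEN continues_summable, OF t], of "a t"] F(2)[OF t]
      by (simp add: algebra_simps)
  qed (auto intro!: holomorphic_intros F summable_mult assms(1)[THEN continues_summable]
        holomorphic_on_subset[OF assms(2)])
qed

lemma continues_cmult: "continues P N f \<Longrightarrow> continues P N (\<lambda>n t. c * f n t)"
  by (rule continues_mult) auto

lemma continues_diff:
  "continues P N f \<Longrightarrow> continues P N g \<Longrightarrow> continues P N (\<lambda>n t. f n t - g n t)"
  using continues_add[OF _ continues_cmult[of P N g "-1"], of f] by simp

lemma continues_zero: "continues P N (\<lambda>_ _. 0)"
  by (auto simp: continues_def intro!: exI[of _ "\<lambda>_. 0"])

lemma continues_sum: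
  "(\<And>i. i \<in> I \<Longrightarrow> continues P N (f i)) \<Longrightarrow> continues P N (\<lambda>n t. \<Sum>i\<in>I. f i n t)"
  by (induction I rule: infinite_finite_induct) (auto intro: continues_add continues_zero)

lemma continues_mono:
  assumes "continues P N f" "P \<subseteq> P'" "finite P'"
  shows "continues P' N f"
proof -
  obtain F where F: "F holomorphic_on {t. Re t > - real N}"
      "\<And>t. Re t > 2 \<Longrightarrow> (\<Prod>s\<in>P. t - s) * (\<Sum>n. f n t) = F t"
    using assms(1) by (auto simp: continues_def)
  have "(\<Prod>s\<in>P'. t - s) = (\<Prod>s\<in>P' - P. t - s) * (\<Prod>s\<in>P. t - s)" for t
    using prod.subset_diff[OF assms(2,3), of "\<lambda>s. t - s"] by simp
  then show ?thesis
    using assms(1) F unfolding continues_def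
    by (intro conjI exI[of _ "\<lambda>t. (\<Prod>s\<in>P' - P. t - s) * F t"])
       (auto intro!: holomorphic_intros simp: mult.assoc)
qed

text \<open>
Candidates for poles arise only here, when a linear factor in front of a series has to be divided out.
\<close>
lemma continues_divide:
  assumes "continues P N (\<lambda>n t. (t - s) * f n t)" "s \<notin> P" "finite P" "Re s \<le> 2"
  shows "continues (insert s P) N f"
proof -
  obtain F where F: "F holomorphic_on {t. Re t > - real N}"
      "\<And>t. Re t > 2 \<Longrightarrow> (\<Prod>s\<in>P. t - s) * (\<Sum>n. (t - s) * f n t) = F t"
    using assms(1) by (auto simp: continues_def)
  have summable: "summable (\<lambda>n. f n t)" if "Re t > 2" for t
  proof -
    have "t \<noteq> s" using that assms(4) by auto
    then show ?thesis
      using summable_mult_D[OF continues_summable[OF assms(1) that]] by simp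
  qed
  show ?thesis
    unfolding continues_def
  proof (intro conjI exI[of _ F] allI impI)
    fix t :: complex assume t: "Re t > 2"
    have "(\<Prod>s\<in>insert s P. t - s) * (\<Sum>n. f n t) = (\<Prod>s\<in>P. t - s) * ((t - s) * (\<Sum>n. f n t))"
      using assms(2,3) by (simp add: mult_ac)
    also have "\<dots> = F t"
      unfolding suminf_mult[OF summable[OF t], symmetric] by (rule F(2)[OF t])
    finally show "(\<Prod>s\<in>insert s P. t - s) * (\<Sum>n. f n t) = F t" .
  qed (use F summable in auto)
qed

text \<open>
Summation by parts in its purest form: the sum is the entire function \<open>- V\<^sub>0\<close>.
\<close>
lemma continues_telescope:
  assumes "V 0 holomorphic_on UNIV" "\<And>t. Re t > 2 \<Longrightarrow> (\<lambda>n. V n t) \<longlonglongrightarrow> 0"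
  shows "continues P N (\<lambda>n t. V (Suc n) t - V n t)"
  unfolding continues_def
proof (intro conjI exI[of _ "\<lambda>t. (\<Prod>s\<in>P. t - s) * - V 0 t"] allI impI)
  fix t :: complex assume "Re t > 2"
  from telescope_sums[OF assms(2)[OF this]]
  have *: "(\<lambda>n. V (Suc n) t - V n t) sums (- V 0 t)" by simp
  then show "summable (\<lambda>n. V (Suc n) t - V n t)" by (rule sums_summable)
  show "(\<Prod>s\<in>P. t - s) * (\<Sum>n. V (Suc n) t - V n t) = (\<Prod>s\<in>P. t - s) * - V 0 t"
    using sums_unique[OF *] by simp
qed (intro holomorphic_intros holomorphic_on_subset[OF assms(1)], auto)

lemma holomorphic_suminf:
  fixes f :: "nat \<Rightarrow> complex \<Rightarrow> complex"
  assumes S: "open S" and hol: "\<And>n. f n holomorphic_on S"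
    and M: "\<And>x. x \<in> S \<Longrightarrow> \<exists>r>0. \<exists>M. summable M \<and> (\<forall>n. \<forall>y\<in>ball x r \<inter> S. norm (f n y) \<le> M n)"
  shows "\<And>t. t \<in> S \<Longrightarrow> summable (\<lambda>n. f n t)" "(\<lambda>t. \<Sum>n. f n t) holomorphic_on S"
proof -
  obtain g where g: "\<forall>x\<in>S. ((\<lambda>n. f n x) sums g x) \<and> g field_differentiable (at x)"
  proof (rule series_differentiable_comparison_complex[OF S, of f])
    fix x assume x: "x \<in> S"
    then obtain r M where r: "r > 0" "summable M" and
      b: "\<And>n y. y \<in> ball x r \<inter> S \<Longrightarrow> norm (f n y) \<le> M n"
      using M by metis
    have "M n \<ge> 0" for n
      using b[of x n] x r by (meson IntI centre_in_ball norm_ge_zero order_trans)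
    then show "\<exists>d h. 0 < d \<and> summable h \<and> range h \<subseteq> \<real>\<^sub>\<ge>\<^sub>0 \<and>
        (\<forall>\<^sub>F n in sequentially. \<forall>y\<in>ball x d \<inter> S. cmod (f n y) \<le> cmod (h n))"
      using r b by (intro exI[of _ r] exI[of _ "\<lambda>n. of_real (M n)"])
        (auto simp: nonneg_Reals_of_real_iff summable_of_real intro!: always_eventually)
  next
    fix n x assume "x \<in> S"
    then show "f n field_differentiable at x"
      using hol S holomorphic_on_imp_differentiable_at by blast
  qed
  show "summable (\<lambda>n. f n t)" if "t \<in> S" for t
    using g that sums_summable by blast
  have "g holomorphic_on S"
    using g by (auto simp: holomorphic_on_def field_differentiable_at_within)
  moreover have "g t = (\<Sum>n. f n t)" if "t \<in> S" for t
    using g that sums_unique by blast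
  ultimately show "(\<lambda>t. \<Sum>n. f n t) holomorphic_on S"
    by (rule holomorphic_transform)
qed

section \<open>Harmonic weights\<close>
definition mesh :: "nat \<Rightarrow> real" where
  "mesh n = 1 / (real n + 2)"

lemma mesh_pos: "mesh n > 0" and mesh_le: "mesh n \<le> 1 / 2" and mesh_small: "mesh n \<in> small_steps"
  and mesh_nonneg: "mesh n \<ge> 0"
  by (auto simp: mesh_def small_steps_def field_simps)

lemma mesh_Suc: "mesh (Suc n) = mesh n / (1 + mesh n)"
  by (simp add: mesh_def field_simps)

lemma mesh_mult: "(real n + 2) * mesh n = 1"
  by (simp add: mesh_def)

lemma summable_mesh_powr: "c > 1 \<Longrightarrow> summable (\<lambda>n. mesh n powr c)"
proof -
  assume "c > 1"
  then have "summable (\<lambda>n. real (n + 2) powr (- c))"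
    using summable_iff_shift[of "\<lambda>n. real n powr (- c)" 2] summable_real_powr_iff[of "- c"] by simp
  then show ?thesis
    by (rule summable_cong[THEN iffD1, rotated])
       (auto simp: mesh_def powr_minus powr_divide field_simps add_ac intro!: always_eventually)
qed

lemma summable_mesh_square: "summable (\<lambda>n. mesh n ^ 2)"
proof -
  have "mesh n powr 2 = mesh n ^ 2" for n
    using mesh_pos[of n] by simp
  then show ?thesis using summable_mesh_powr[of 2] by simp
qed

text \<open>
The induction starts here: terms that are \<open>O(n\<^sup>-\<^sup>2)\<close> in the half plane give a
holomorphic sum by the Weierstrass test.
\<close>
lemma continues_tail:
  assumes hol: "\<And>n. f n holomorphic_on UNIV"
    and bound: "\<And>R. \<exists>C. \<forall>n t. norm t \<le> R \<longrightarrow> Re t > - real N \<longrightarrow> norm (f n t) \<le> C * mesh n ^ 2"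
  shows "continues P N f"
proof -
  have S: "open {t. Re t > - real N}" by (rule open_halfspace_Re_gt)
  have M: "\<exists>r>0. \<exists>M. summable M \<and> (\<forall>n. \<forall>y\<in>ball x r \<inter> {t. Re t > - real N}. norm (f n y) \<le> M n)" for x
  proof -
    obtain C where C: "\<And>n t. norm t \<le> norm x + 1 \<Longrightarrow> Re t > - real N \<Longrightarrow> norm (f n t) \<le> C * mesh n ^ 2"
      using bound by meson
    have "norm y \<le> norm x + 1" if "y \<in> ball x 1" for y
      using that norm_triangle_ineq2[of y x] by (simp add: dist_norm norm_minus_commute)
    then have "\<forall>n. \<forall>y\<in>ball x 1 \<inter> {t. Re t > - real N}. norm (f n y) \<le> C * mesh n ^ 2"
      using C by blast
    then show ?thesis
      by (intro exI[of _ 1] exI[of _ "\<lambda>n. C * mesh n ^ 2"] conjI summable_mult summable_mesh_square) auto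
  qed
  note * = holomorphic_suminf[OF S holomorphic_on_subset[OF hol subset_UNIV] M]
  show ?thesis
    unfolding continues_def
    by (intro conjI exI[of _ "\<lambda>t. (\<Prod>s\<in>P. t - s) * (\<Sum>n. f n t)"])
       (use * in \<open>auto intro!: holomorphic_intros\<close>)
qed

lemma harm_le_ln: "harm (Suc n) \<le> 1 + ln (real (Suc n))"
  using decseqD[OF decseq_harm_diff_ln, of 0 n] by (simp add: harm_expand)

text \<open>
The factor \<open>real n + 2\<close> is one negative power of the step, so that the terms of \<^const>\<open>K2_series\<close> have \<open>k = 0\<close>
and only natural exponents occur.
\<close>
definition weight :: "nat \<Rightarrow> nat \<Rightarrow> complex \<Rightarrow> complex" where
  "weight k n t = of_real ((real n + 2) * mesh n ^ k) * exp (- t * harm (Suc n))"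

lemma norm_exp_harm: "norm (exp (- t * harm n)) = exp (- Re t * harm n)"
proof -
  have "Re (- t * of_real (harm n)) = - Re t * harm n" by simp
  then show ?thesis by (simp only: of_real_harm norm_exp_eq_Re)
qed

lemma norm_exp_harm_decay:
  assumes "Re t \<ge> 0"
  shows "norm (exp (- t * harm (Suc n))) \<le> mesh n powr Re t"
proof -
  have "Re t * ln (real n + 2) \<le> Re t * harm (Suc n)"
    using harm_ge_ln[of "Suc n"] assms by (intro mult_left_mono) (auto simp: add_ac)
  then have "norm (exp (- t * harm (Suc n))) \<le> exp (- Re t * ln (real n + 2))"
    unfolding norm_exp_harm by simp
  also have "\<dots> = mesh n powr Re t"
    by (simp add: mesh_def powr_def ln_div)
  finally show ?thesis .
qed

lemma norm_exp_harm_growth: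
  assumes "Re t > - real N"
  shows "norm (exp (- t * harm (Suc n))) * mesh n ^ N \<le> exp (real N)"
proof -
  have "- Re t * harm (Suc n) \<le> real N * harm (Suc n)"
    using assms harm_nonneg[of "Suc n", where 'a = real] by (intro mult_right_mono) auto
  also have "\<dots> \<le> real N * (1 + ln (real n + 2))"
  proof (intro mult_left_mono)
    have "ln (real (Suc n)) \<le> ln (real n + 2)" by simp
    then show "harm (Suc n) \<le> 1 + ln (real n + 2)"
      using harm_le_ln[of n] by linarith
  qed auto
  finally have "norm (exp (- t * harm (Suc n))) \<le> exp (real N * (1 + ln (real n + 2)))"
    unfolding norm_exp_harm by simp
  also have "\<dots> = exp (real N) * (real n + 2) ^ N"
    by (simp add: distrib_left exp_add exp_of_nat_mult)
  finally have "norm (exp (- t * harm (Suc n))) * mesh n ^ N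
      \<le> exp (real N) * (real n + 2) ^ N * mesh n ^ N"
    by (intro mult_right_mono) (auto simp: mesh_nonneg)
  also have "\<dots> = exp (real N)"
    using mesh_mult[of n] by (simp add: mult.assoc power_mult_distrib[symmetric])
  finally show ?thesis .
qed

lemma weight_eq_weight_0: "weight k n t = of_real (mesh n) ^ k * weight 0 n t"
  by (simp add: weight_def)

lemma weight_Suc_index: "weight (Suc k) n t = of_real (mesh n) * weight k n t"
  by (simp add: weight_def)

lemma weight_holomorphic: "weight k n holomorphic_on UNIV"
  unfolding weight_def[abs_def] by (intro holomorphic_intros)

definition weight_ratio :: "nat \<Rightarrow> real \<Rightarrow> complex \<Rightarrow> complex" where
  "weight_ratio k z t =
     (1 + of_real (1 * z)) * inverse (1 + of_real (1 * z)) ^ k * exp (of_real (- 1 * z) * t)"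

lemma weight_shift: "weight k (Suc n) t = weight k n t * weight_ratio k (mesh n) t"
proof -
  have H: "harm (Suc (Suc n)) = harm (Suc n) + complex_of_real (mesh n)"
    by (simp add: harm_Suc[of "Suc n"] mesh_def field_simps)
  have m: "real (Suc n) + 2 = (real n + 2) * (1 + mesh n)"
    by (simp add: mesh_def field_simps)
  have "exp (- t * harm (Suc (Suc n))) = exp (- t * harm (Suc n)) * exp (of_real (- 1 * mesh n) * t)"
    unfolding H by (simp add: exp_add[symmetric] algebra_simps)
  moreover have "(real (Suc n) + 2) * mesh (Suc n) ^ k =
      (real n + 2) * mesh n ^ k * ((1 + mesh n) * inverse (1 + mesh n) ^ k)"
    unfolding m mesh_Suc by (simp add: power_divide power_inverse[symmetric] divide_inverse power_mult_distrib)
  ultimately show ?thesis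
    by (simp only: weight_def weight_ratio_def) simp
qed

text \<open>
To first order \<open>(n + 2) z\<^sup>k W\<^sub>n\<close> behaves like the power of \<open>n\<close> with exponent \<open>1 - k - t\<close>.
\<close>
lemma two_term_expansion_weight_ratio:
  "two_term_expansion (weight_ratio k) (\<lambda>_. 1) (\<lambda>t. 1 - of_nat k - t)"
proof -
  have "two_term_expansion (weight_ratio k) (\<lambda>t. (1 * 1) * 1)
     (\<lambda>t. (1 * 1) * (of_real (-1) * t) + (1 * (of_nat k * (- of_real 1)) + of_real 1 * 1) * 1)"
    unfolding weight_ratio_def[abs_def]
    by (intro two_term_expansion_mult two_term_expansion_one_plus two_term_expansion_power
        two_term_expansion_inverse_one_plus two_term_expansion_exp) auto
  then show ?thesis by (simp add: algebra_simps)
qed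

lemma weight_square_tendsto:
  assumes "Re t > 2"
  shows "(\<lambda>n. of_real (real n + 2) * weight 0 n t) \<longlonglongrightarrow> 0"
proof (rule Lim_null_comparison)
  have "norm (of_real (real n + 2) * weight 0 n t) \<le> mesh n powr (Re t - 2)" for n
  proof -
    have "norm (of_real (real n + 2) * weight 0 n t) =
        (real n + 2) ^ 2 * norm (exp (- t * harm (Suc n)))"
      by (simp add: weight_def norm_mult power2_eq_square del: of_real_add)
    also have "\<dots> \<le> (real n + 2) ^ 2 * mesh n powr Re t"
      using norm_exp_harm_decay[of t n] assms by (intro mult_left_mono) auto
    also have "\<dots> = ((real n + 2) * mesh n) ^ 2 * mesh n powr (Re t - 2)"
      using mesh_pos[of n] by (simp add: powr_diff powr_numeral power_mult_distrib)
    finally show ?thesis by (simp add: mesh_mult)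
  qed
  then show "\<forall>\<^sub>F n in sequentially. norm (of_real (real n + 2) * weight 0 n t) \<le> mesh n powr (Re t - 2)"
    by simp
  have "(\<lambda>n. mesh n powr (Re t - 2)) \<longlonglongrightarrow> 0"
  proof (rule tendsto_zero_powrI)
    show "mesh \<longlonglongrightarrow> 0"
      unfolding mesh_def using LIMSEQ_ignore_initial_segment[OF lim_1_over_n[where 'a = real], of 2]
      by (simp add: add_ac)
  qed (use assms mesh_nonneg in auto)
  then show "(\<lambda>n. mesh n powr (Re t - 2)) \<longlonglongrightarrow> 0" .
qed

text \<open>
In the half plane \<open>W\<^sub>n\<close> grows at most like \<open>n\<^sup>N\<close>. With the factor \<open>n + 2\<close> in the weight, \<open>N + 3\<close> powers of the
step leave \<open>O(n\<^sup>-\<^sup>2)\<close>.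
\<close>
lemma continues_base:
  assumes F: "bounded_family F" and X: "\<And>n. \<bar>X n\<bar> \<le> B"
  shows "continues P N (\<lambda>n t. weight (N + 3) n t * F (mesh n) t * of_real (X n))"
proof (rule continues_tail)
  show "(\<lambda>t. weight (N + 3) n t * F (mesh n) t * of_real (X n)) holomorphic_on UNIV" for n
    by (intro holomorphic_intros weight_holomorphic bounded_family_holomorphic[OF F] mesh_small)
next
  fix R
  obtain C where C: "C \<ge> 0" "\<And>z t. z \<in> small_steps \<Longrightarrow> norm t \<le> R \<Longrightarrow> norm (F z t) \<le> C"
    using bounded_family_bound[OF F] by metis
  have "norm (weight (N + 3) n t * F (mesh n) t * of_real (X n)) \<le> (exp (real N) * C * B) * mesh n ^ 2"
    if t: "norm t \<le> R" "Re t > - real N" for n t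
  proof -
    have "norm (weight (N + 3) n t) =
        ((real n + 2) * mesh n) * mesh n ^ 2 * (norm (exp (- t * harm (Suc n))) * mesh n ^ N)"
      using mesh_nonneg[of n]
      by (simp add: weight_def norm_mult power_add numeral_eq_Suc norm_power del: of_real_add of_real_mult)
    also have "\<dots> \<le> mesh n ^ 2 * exp (real N)"
      using norm_exp_harm_growth[OF t(2), of n] by (simp add: mesh_mult mult_left_mono)
    finally have "norm (weight (N + 3) n t) \<le> mesh n ^ 2 * exp (real N)" .
    then have "norm (weight (N + 3) n t) * norm (F (mesh n) t) * \<bar>X n\<bar>
        \<le> (mesh n ^ 2 * exp (real N)) * C * B"
      using C mesh_small t X by (intro mult_mono mult_nonneg_nonneg) auto
    then show ?thesis by (simp add: norm_mult mult_ac)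
  qed
  then show "\<exists>C. \<forall>n t. norm t \<le> R \<longrightarrow> Re t > - real N \<longrightarrow>
      norm (weight (N + 3) n t * F (mesh n) t * of_real (X n)) \<le> C * mesh n ^ 2"
    by blast
qed


section \<open>Legendre polynomials and their products\<close>
definition legendre :: "nat \<Rightarrow> real \<Rightarrow> real" where
  "legendre n x = poly (legendre_poly n) x"

lemma legendre_0 [simp]: "legendre 0 x = 1" and legendre_1 [simp]: "legendre (Suc 0) x = x"
  by (simp_all add: legendre_def)

lemma legendre_Suc_Suc:
  "legendre (Suc (Suc n)) x = (2 - mesh n) * x * legendre (Suc n) x - (1 - mesh n) * legendre n x"
proof -
  have *: "2 - mesh n = (2 * real n + 3) / (real n + 2)" "1 - mesh n = (real n + 1) / (real n + 2)"
    by (simp_all add: mesh_def field_simps)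
  show ?thesis unfolding * by (simp add: legendre_def diff_divide_distrib add_divide_distrib algebra_simps)
qed

text \<open>
The form that the recursion matrix at \<open>z = 0\<close> preserves. For \<open>\<bar>x\<bar> < 1\<close>, multiplied by \<open>(n + 1)\<^sup>2 / (2 (1 - x\<^sup>2))\<close>,
it is the sum of \<open>(2 k + 1) / 2\<close> times the square of the \<open>k\<close>-th polynomial over \<open>k \<le> n\<close>.
\<close>
definition legendre_form :: "real \<Rightarrow> nat \<Rightarrow> real" where
  "legendre_form x n =
     legendre (Suc n) x ^ 2 - 2 * x * legendre (Suc n) x * legendre n x + legendre n x ^ 2"

lemma legendre_form_Suc:
  "legendre_form x (Suc n) =
     (1 - mesh n)\<^sup>2 * legendre_form x n + (1 - x\<^sup>2) * mesh n * (2 - mesh n) * legendre (Suc n) x ^ 2"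
  unfolding legendre_form_def legendre_Suc_Suc by algebra

text \<open>
Complete the square in either variable.
\<close>
lemma legendre_form_ge:
  "(1 - x\<^sup>2) * legendre (Suc n) x ^ 2 \<le> legendre_form x n"
  "(1 - x\<^sup>2) * legendre n x ^ 2 \<le> legendre_form x n"
proof -
  have "legendre_form x n - (1 - x\<^sup>2) * legendre (Suc n) x ^ 2 = (legendre n x - x * legendre (Suc n) x) ^ 2"
    "legendre_form x n - (1 - x\<^sup>2) * legendre n x ^ 2 = (legendre (Suc n) x - x * legendre n x) ^ 2"
    unfolding legendre_form_def by algebra+
  then show "(1 - x\<^sup>2) * legendre (Suc n) x ^ 2 \<le> legendre_form x n"
    "(1 - x\<^sup>2) * legendre n x ^ 2 \<le> legendre_form x n"
    using zero_le_power2 by (metis diff_ge_0_iff_ge)+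
qed

text \<open>
The form decreases in \<open>n\<close>: what the exact recursion adds is bounded by \<open>legendre_form_ge\<close> exactly by what it
takes away.
\<close>
lemma legendre_form_le: "legendre_form x n \<le> 1 - x\<^sup>2"
proof (induction n)
  case 0
  then show ?case by (simp add: legendre_form_def power2_eq_square)
next
  case (Suc n)
  have "legendre_form x (Suc n) \<le>
      (1 - mesh n)\<^sup>2 * legendre_form x n + mesh n * (2 - mesh n) * legendre_form x n"
    unfolding legendre_form_Suc
    using mult_left_mono[OF legendre_form_ge(1)[of x n], of "mesh n * (2 - mesh n)"]
      mesh_nonneg[of n] mesh_le[of n] by (simp add: mult_ac)
  also have "\<dots> = legendre_form x n" by (simp add: power2_eq_square algebra_simps)
  finally show ?case using Suc by simp
qed

lemma legendre_endpoint: "legendre n 1 = 1" "legendre n (- 1) = (- 1) ^ n"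
proof -
  have "legendre n 1 = 1 \<and> legendre (Suc n) 1 = 1"
    by (induction n) (auto simp: legendre_Suc_Suc algebra_simps)
  then show "legendre n 1 = 1" ..
  have "legendre n (- 1) = (- 1) ^ n \<and> legendre (Suc n) (- 1) = (- 1) ^ Suc n"
    by (induction n) (auto simp: legendre_Suc_Suc algebra_simps)
  then show "legendre n (- 1) = (- 1) ^ n" ..
qed

text \<open>
In the interior compare \<open>legendre_form_ge\<close> with \<open>legendre_form_le\<close>; the factor \<open>1 - x\<^sup>2\<close> cancels.
\<close>
lemma abs_legendre_le_1:
  assumes "\<bar>x\<bar> \<le> 1"
  shows "\<bar>legendre n x\<bar> \<le> 1"
proof (cases "\<bar>x\<bar> = 1")
  case True
  then have "x = 1 \<or> x = -1" by linarith
  then show ?thesis by (auto simp: legendre_endpoint power_abs)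
next
  case False
  then have "1 - x\<^sup>2 > 0" using assms abs_square_less_1[of x] by simp
  moreover have "(1 - x\<^sup>2) * legendre n x ^ 2 \<le> (1 - x\<^sup>2) * 1"
    using legendre_form_ge(2)[of x n] legendre_form_le[of x n] by simp
  ultimately have "legendre n x ^ 2 \<le> 1" by (simp only: mult_le_cancel_left_pos)
  then show ?thesis by (simp add: abs_square_le_1)
qed

definition legendre_prod :: "real \<Rightarrow> real \<Rightarrow> nat \<Rightarrow> nat \<Rightarrow> real" where
  "legendre_prod x y i n =
     [legendre (Suc n) x * legendre (Suc n) y, legendre (Suc n) x * legendre n y,
      legendre n x * legendre (Suc n) y, legendre n x * legendre n y] ! i"

lemma legendre_prod_simps:
  "legendre_prod x y 0 n = legendre (Suc n) x * legendre (Suc n) y"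
  "legendre_prod x y 1 n = legendre (Suc n) x * legendre n y"
  "legendre_prod x y (Suc 0) n = legendre (Suc n) x * legendre n y"
  "legendre_prod x y 2 n = legendre n x * legendre (Suc n) y"
  "legendre_prod x y 3 n = legendre n x * legendre n y"
  by (simp_all add: legendre_prod_def)

lemma less_4: "i < (4::nat) \<longleftrightarrow> i = 0 \<or> i = 1 \<or> i = 2 \<or> i = 3"
  by auto

lemma abs_legendre_prod_le:
  assumes "\<bar>x\<bar> \<le> 1" "\<bar>y\<bar> \<le> 1" "i < 4"
  shows "\<bar>legendre_prod x y i n\<bar> \<le> 1"
  using assms(3) unfolding less_4
  by (auto simp: legendre_prod_simps abs_mult intro!: mult_le_one abs_legendre_le_1 assms(1,2))

lemma weight_tendsto_0:
  assumes "Re t > 2" "\<And>n. \<bar>c n\<bar> \<le> B"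
  shows "(\<lambda>n. of_real (real n + 2) * weight 0 n t * of_real (c n)) \<longlonglongrightarrow> 0"
  by (rule lim_null_mult_right_bounded[where B = B, OF weight_square_tendsto[OF assms(1)]])
     (use assms(2) in auto)

lemma weight_eq: "weight k n t = of_real (real n + 2) * weight 0 n t * of_real (mesh n ^ Suc k)"
proof -
  have "complex_of_real (real n + 2) * of_real (mesh n) = 1"
    using mesh_mult[of n] by (metis of_real_1 of_real_mult)
  then show ?thesis
    by (simp add: weight_eq_weight_0[of k] del: of_real_add)
qed

text \<open>
Telescoping \<open>(n + 2) z\<^sup>k W\<^sub>n X\<^sub>i\<close>. The matrix of the recursion at \<open>z = 0\<close> is \<open>a\<close>; everything else carries one more
factor \<open>z\<close> and is covered by the hypothesis on lower order terms.
\<close>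
lemma continues_system_step:
  fixes X :: "nat \<Rightarrow> nat \<Rightarrow> real"
  assumes lower: "\<And>F j. j < m \<Longrightarrow> (\<And>d. expandable d F) \<Longrightarrow>
      continues P N (\<lambda>n t. weight (Suc k) n t * F (mesh n) t * of_real (X j n))"
    and rec: "\<And>n. X i (Suc n) = (\<Sum>j<m. (a j + mesh n * b j (mesh n)) * X j n)"
    and b: "\<And>j d. expandable d (\<lambda>z _. of_real (b j z))"
    and bound: "\<And>n. \<bar>X i n\<bar> \<le> B"
  shows "continues P N (\<lambda>n t. weight k n t * of_real ((\<Sum>j<m. a j * X j n) - X i n))"
proof -
  obtain H where H: "\<And>d. expandable d H"
    "\<And>z t. z \<in> small_steps \<Longrightarrow> weight_ratio k z t = 1 + of_real z * (1 - of_nat k - t) + of_real z ^ 2 * H z t"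
    using two_term_expansionD[OF two_term_expansion_weight_ratio[of k]] by metis
  define G where "G z t = 1 - of_nat k - t + of_real z * H z t" for z t
  have G: "expandable d G" for d
    unfolding G_def by (intro expandable_intros holomorphic_intros H)
  define L where "L j z t = of_real (b j z) + G z t * (of_real (a j) + of_real z * of_real (b j z))" for j z t
  have L: "expandable d (L j)" for j d
    unfolding L_def by (intro expandable_intros holomorphic_intros G b)
  have tele: "continues P N (\<lambda>n t. weight k (Suc n) t * of_real (X i (Suc n)) - weight k n t * of_real (X i n))"
  proof (rule continues_telescope)
    fix t :: complex assume t: "Re t > 2"
    have "\<bar>mesh n ^ Suc k * X i n\<bar> \<le> 1 * B" for n
      unfolding abs_mult using mesh_nonneg[of n] mesh_le[of n] bound
      by (intro mult_mono) (auto intro!: power_le_one mult_le_one simp: abs_mult)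
    from weight_tendsto_0[OF t this]
    show "(\<lambda>n. weight k n t * of_real (X i n)) \<longlonglongrightarrow> 0"
      by (subst weight_eq) (simp add: mult.assoc)
  qed (intro holomorphic_intros weight_holomorphic)
  have "continues P N (\<lambda>n t. (weight k (Suc n) t * of_real (X i (Suc n)) - weight k n t * of_real (X i n))
      - (\<Sum>j<m. weight (Suc k) n t * L j (mesh n) t * of_real (X j n)))"
    by (intro continues_diff tele continues_sum lower L) auto
  then show ?thesis
  proof (rule continues_cong)
    fix n t
    let ?z = "complex_of_real (mesh n)"
    have ratio: "weight_ratio k (mesh n) t = 1 + ?z * G (mesh n) t"
      using H(2)[OF mesh_small] by (simp add: G_def algebra_simps power2_eq_square)
    have collapse: "(1 + ?z * G (mesh n) t) * ((of_real (a j) + ?z * of_real (b j (mesh n))) * of_real (X j n))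
        - ?z * L j (mesh n) t * of_real (X j n) = of_real (a j * X j n)" for j
      by (simp add: L_def algebra_simps)
    have sum_eq: "(1 + ?z * G (mesh n) t) * of_real (X i (Suc n)) - (\<Sum>j<m. ?z * L j (mesh n) t * of_real (X j n))
        = of_real (\<Sum>j<m. a j * X j n)"
      unfolding rec of_real_sum sum_distrib_left sum_subtractf[symmetric]
      by (intro sum.cong refl) (use collapse in simp)
    show "weight k (Suc n) t * of_real (X i (Suc n)) - weight k n t * of_real (X i n)
      - (\<Sum>j<m. weight (Suc k) n t * L j (mesh n) t * of_real (X j n)) =
        weight k n t * of_real ((\<Sum>j<m. a j * X j n) - X i n)"
      unfolding weight_shift ratio weight_Suc_index
      using arg_cong[OF sum_eq, of "\<lambda>u. weight k n t * u"]
      by (simp add: sum_distrib_left algebra_simps)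
  qed
qed

text \<open>
Peeling off the leading coefficient reduces an arbitrary coefficient family to the constant one.
\<close>
lemma continues_expandable_Suc:
  assumes pure: "continues P N (\<lambda>n t. weight k n t * of_real (X n))"
    and lower: "\<And>G. expandable d G \<Longrightarrow> continues P N (\<lambda>n t. weight (Suc k) n t * G (mesh n) t * of_real (X n))"
    and F: "expandable (Suc d) F"
  shows "continues P N (\<lambda>n t. weight k n t * F (mesh n) t * of_real (X n))"
proof -
  obtain a G where *: "a holomorphic_on UNIV" "expandable d G"
      "\<And>z t. z \<in> small_steps \<Longrightarrow> F z t = a t + of_real z * G z t"
    using F by auto
  have "continues P N (\<lambda>n t. a t * (weight k n t * of_real (X n)) + weight (Suc k) n t * G (mesh n) t * of_real (X n))"
    by (intro continues_add continues_mult pure lower *)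
  then show ?thesis
    by (rule continues_cong) (simp add: *(3)[OF mesh_small] weight_Suc_index algebra_simps)
qed

context
  fixes x y :: real and P :: "complex set" and N k :: nat
  assumes xy: "\<bar>x\<bar> \<le> 1" "\<bar>y\<bar> \<le> 1"
    and lower: "\<forall>j<4. \<forall>F. (\<forall>d. expandable d F) \<longrightarrow>
      continues P N (\<lambda>n t. weight (Suc k) n t * F (mesh n) t * of_real (legendre_prod x y j n))"
begin

lemma legendre_prod_relation:
  assumes i: "i < 4" and len: "length a = 4" "length b = 4" "length c = 4"
    and rec: "\<And>n. legendre_prod x y i (Suc n) =
      (\<Sum>j<4. (a ! j + mesh n * (b ! j + c ! j * mesh n)) * legendre_prod x y j n)"
  shows "continues P N (\<lambda>n t. weight k n t *
           of_real ((\<Sum>j<4. a ! j * legendre_prod x y j n) - legendre_prod x y i n))"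
proof (rule continues_system_step[where b = "\<lambda>j z. b ! j + c ! j * z" and B = 1])
  show "expandable d (\<lambda>z _. complex_of_real (b ! j + c ! j * z))" for d j
    unfolding of_real_add of_real_mult by (intro expandable_intros holomorphic_intros)
qed (use lower rec abs_legendre_prod_le[OF xy i] in auto)

text \<open>
Leading order relations between the four series, one for each component. The expressions are the rows of \<open>M - 1\<close>,
where \<open>M\<close> is the tensor product of the limiting recursion matrices for \<open>x\<close> and \<open>y\<close>.
\<close>
lemma legendre_prod_relations:
  "continues P N (\<lambda>n t. weight k n t * of_real (4 * x * y * legendre_prod x y 0 n
      - 2 * x * legendre_prod x y 1 n - 2 * y * legendre_prod x y 2 n + legendre_prod x y 3 n
      - legendre_prod x y 0 n))"
  "continues P N (\<lambda>n t. weight k n t * of_real (2 * x * legendre_prod x y 0 n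
      - legendre_prod x y 2 n - legendre_prod x y 1 n))"
  "continues P N (\<lambda>n t. weight k n t * of_real (2 * y * legendre_prod x y 0 n
      - legendre_prod x y 1 n - legendre_prod x y 2 n))"
  "continues P N (\<lambda>n t. weight k n t * of_real (legendre_prod x y 0 n - legendre_prod x y 3 n))"
proof -
  have sum4: "(\<Sum>j<4. f j) = f 0 + f 1 + f 2 + f (3::nat)" for f :: "nat \<Rightarrow> real"
    by (simp add: eval_nat_numeral)
  have nth: "[u, v, w, p] ! 1 = v" "[u, v, w, p] ! 2 = w" "[u, v, w, p] ! 3 = p" for u v w p :: real
    by auto
  note simps = sum4 nth nth_Cons_0 legendre_prod_simps legendre_Suc_Suc
  have "continues P N (\<lambda>n t. weight k n t *
           of_real ((\<Sum>j<4. [4 * x * y, - 2 * x, - 2 * y, 1] ! j * legendre_prod x y j n) - legendre_prod x y 0 n))"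
    by (rule legendre_prod_relation[where b = "[- 4 * x * y, 3 * x, 3 * y, - 2]" and c = "[x * y, - x, - y, 1]"])
       (simp_all only: simps, simp_all add: algebra_simps)
  then show "continues P N (\<lambda>n t. weight k n t * of_real (4 * x * y * legendre_prod x y 0 n
      - 2 * x * legendre_prod x y 1 n - 2 * y * legendre_prod x y 2 n + legendre_prod x y 3 n
      - legendre_prod x y 0 n))"
    by (rule continues_cong) (simp only: sum4 nth nth_Cons_0, simp)
  have "continues P N (\<lambda>n t. weight k n t *
           of_real ((\<Sum>j<4. [2 * x, 0, - 1, 0] ! j * legendre_prod x y j n) - legendre_prod x y 1 n))"
    by (rule legendre_prod_relation[where b = "[- x, 0, 1, 0]" and c = "[0, 0, 0, 0]"])
       (simp_all only: simps, simp_all add: algebra_simps)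
  then show "continues P N (\<lambda>n t. weight k n t * of_real (2 * x * legendre_prod x y 0 n
      - legendre_prod x y 2 n - legendre_prod x y 1 n))"
    by (rule continues_cong) (simp only: sum4 nth nth_Cons_0, simp)
  have "continues P N (\<lambda>n t. weight k n t *
           of_real ((\<Sum>j<4. [2 * y, - 1, 0, 0] ! j * legendre_prod x y j n) - legendre_prod x y 2 n))"
    by (rule legendre_prod_relation[where b = "[- y, 1, 0, 0]" and c = "[0, 0, 0, 0]"])
       (simp_all only: simps, simp_all add: algebra_simps)
  then show "continues P N (\<lambda>n t. weight k n t * of_real (2 * y * legendre_prod x y 0 n
      - legendre_prod x y 1 n - legendre_prod x y 2 n))"
    by (rule continues_cong) (simp only: sum4 nth nth_Cons_0, simp)
  have "continues P N (\<lambda>n t. weight k n t *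
           of_real ((\<Sum>j<4. [1, 0, 0, 0] ! j * legendre_prod x y j n) - legendre_prod x y 3 n))"
    by (rule legendre_prod_relation[where b = "[0, 0, 0, 0]" and c = "[0, 0, 0, 0]"])
       (simp_all only: simps, simp_all add: algebra_simps)
  then show "continues P N (\<lambda>n t. weight k n t * of_real (legendre_prod x y 0 n - legendre_prod x y 3 n))"
    by (rule continues_cong) (simp only: sum4 nth nth_Cons_0, simp)
qed

end

text \<open>
Explicit inversion of \<open>M - 1\<close>. The difference of the second and third relation is \<open>2 (x - y)\<close> times the
first product, which is the Christoffel-Darboux formula in disguise. Since only \<open>x - y\<close> is inverted, the end points
\<open>\<plusminus> 1\<close>, where the recursion matrix is not diagonalisable, cause no trouble.
\<close>
lemma offdiagonal_step:
  assumes xy: "\<bar>x\<bar> \<le> 1" "\<bar>y\<bar> \<le> 1" "x \<noteq> y" and i: "i < 4"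
    and lower: "\<forall>j<4. \<forall>F. (\<forall>d. expandable d F) \<longrightarrow>
      continues P N (\<lambda>n t. weight (Suc k) n t * F (mesh n) t * of_real (legendre_prod x y j n))"
  shows "continues P N (\<lambda>n t. weight k n t * of_real (legendre_prod x y i n))"
proof -
  note rel = legendre_prod_relations[OF xy(1,2) lower]
  have nz: "complex_of_real x - of_real y \<noteq> 0" using xy(3) by simp
  have A: "continues P N (\<lambda>n t. weight k n t * of_real (legendre_prod x y 0 n))"
    by (rule continues_cong[OF continues_cmult[OF continues_diff[OF rel(2,3)], of "1 / (2 * (of_real x - of_real y))"]])
       (use nz in \<open>simp_all add: divide_simps\<close>, simp add: algebra_simps)
  have D: "continues P N (\<lambda>n t. weight k n t * of_real (legendre_prod x y 3 n))"
    by (rule continues_cong[OF continues_diff[OF A rel(4)]]) (simp_all add: algebra_simps)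
  have B: "continues P N (\<lambda>n t. weight k n t * of_real (legendre_prod x y 1 n))"
    by (rule continues_cong[OF continues_cmult[OF
          continues_diff[OF continues_add[OF rel(1,4)] continues_cmult[OF rel(2), of "2 * of_real y"]],
          of "- 1 / (2 * (of_real x - of_real y))"]])
       (use nz in \<open>simp_all add: divide_simps\<close>, simp add: algebra_simps)
  have C: "continues P N (\<lambda>n t. weight k n t * of_real (legendre_prod x y 2 n))"
    by (rule continues_cong[OF continues_diff[OF continues_diff[OF continues_cmult[OF A, of "2 * of_real x"] B] rel(2)]])
       (simp_all add: algebra_simps)
  show ?thesis using i A B C D unfolding less_4 by auto
qed

text \<open>
The exponent \<open>k\<close> and the remaining order \<open>d\<close> of the expansion add up to \<open>N + 3\<close>, the exponent
at which the series converges.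
\<close>
lemma continues_offdiagonal:
  assumes xy: "\<bar>x\<bar> \<le> 1" "\<bar>y\<bar> \<le> 1" "x \<noteq> y"
  shows "k + d = N + 3 \<Longrightarrow> i < 4 \<Longrightarrow> expandable d F \<Longrightarrow>
    continues {} N (\<lambda>n t. weight k n t * F (mesh n) t * of_real (legendre_prod x y i n))"
proof (induction d arbitrary: k i F)
  case 0
  then show ?case
    using continues_base[of F "legendre_prod x y i" 1] abs_legendre_prod_le[OF xy(1,2)] by simp
next
  case (Suc d)
  show ?case
    by (rule continues_expandable_Suc[OF offdiagonal_step[OF xy] Suc.IH Suc.prems(3)])
       (use Suc.prems Suc.IH in auto)
qed

lemma K2_term_eq_weight:
  "K2_term t x y (Suc n) =
     weight 0 n t * (1 - of_real (mesh n) / 2) * of_real (legendre_prod x y 0 n)"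
proof -
  have "(real n + 2) * (1 - mesh n / 2) = (2 * real (Suc n) + 1) / 2"
    using mesh_mult[of n] by (simp add: algebra_simps)
  then have "complex_of_real ((real n + 2) * (1 - mesh n / 2)) = of_real ((2 * real (Suc n) + 1) / 2)"
    by (rule arg_cong)
  then have "(2 * of_nat (Suc n) + 1) / 2 = complex_of_real ((real n + 2) * (1 - mesh n / 2))"
    by simp
  then show ?thesis
    by (simp add: K2_term_def weight_def legendre_prod_simps legendre_def)
qed

lemma continues_K2_offdiagonal:
  assumes "\<bar>x\<bar> \<le> 1" "\<bar>y\<bar> \<le> 1" "x \<noteq> y"
  shows "continues {} N (\<lambda>n t. K2_term t x y (Suc n))"
proof -
  have "expandable (N + 3) (\<lambda>z _. 1 - of_real z * (1 / 2))"
    by (intro expandable_intros holomorphic_intros)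
  from continues_offdiagonal[OF assms _ _ this, of 0 N 0]
  show ?thesis by (simp add: K2_term_eq_weight)
qed


section \<open>The diagonal in the interior of the interval\<close>
lemma legendre_form_eq_prods:
  "legendre_form x n = legendre_prod x x 0 n - 2 * x * legendre_prod x x 1 n + legendre_prod x x 3 n"
  by (simp add: legendre_form_def legendre_prod_simps power2_eq_square)

lemma legendre_prod_sym: "legendre_prod x x 2 n = legendre_prod x x 1 n"
  by (simp add: legendre_prod_simps)

lemma legendre_form_nonneg: "\<bar>x\<bar> \<le> 1 \<Longrightarrow> legendre_form x n \<ge> 0"
  using legendre_form_ge(1)[of x n] abs_square_le_1[of x]
  by (meson diff_ge_0_iff_ge mult_nonneg_nonneg order_trans zero_le_power2)

text \<open>
The telescope is \<open>(n + 2) z\<^sup>k (1 - z)\<^sup>2 W\<^sub>n Q\<^sub>n\<close>. As \<open>(n + 2) (1 - z) = n + 1\<close>, this is the product of \<open>(n + 1)\<^sup>2 Q\<^sub>n\<close>, whose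
increments are known exactly, and \<open>z\<^sup>k\<^sup>+\<^sup>1 W\<^sub>n\<close>.
\<close>
lemma diagonal_telescope:
  assumes x: "\<bar>x\<bar> \<le> 1"
    and G: "\<And>t n. weight_ratio (Suc k) (mesh n) t = 1 + of_real (mesh n) * G (mesh n) t"
  shows "continues P N (\<lambda>n t. weight k n t *
           (G (mesh n) t * (1 - of_real (mesh n))\<^sup>2 * of_real (legendre_form x n)
            + (1 + of_real (mesh n) * G (mesh n) t) * of_real (1 - x\<^sup>2) * (2 - of_real (mesh n))
              * of_real (legendre_prod x x 0 n)))"
proof -
  define c where "c n = mesh n ^ k * ((1 - mesh n)\<^sup>2 * legendre_form x n)" for n
  define V where "V n t = of_real (real n + 2) * weight 0 n t * of_real (c n)" for n t
  have "continues P N (\<lambda>n t. V (Suc n) t - V n t)"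
  proof (rule continues_telescope)
    show "V 0 holomorphic_on UNIV"
      unfolding V_def[abs_def] by (intro holomorphic_intros weight_holomorphic)
    fix t :: complex assume t: "Re t > 2"
    have "\<bar>c n\<bar> \<le> 1" for n
    proof -
      have "legendre_form x n \<le> 1" using legendre_form_le[of x n] by (smt (verit) zero_le_power2)
      then show ?thesis
        using legendre_form_nonneg[OF x, of n] mesh_nonneg[of n] mesh_le[of n]
        unfolding c_def abs_mult by (intro mult_le_one) (auto intro: power_le_one mult_le_one)
    qed
    from weight_tendsto_0[OF t this] show "(\<lambda>n. V n t) \<longlonglongrightarrow> 0"
      unfolding V_def .
  qed
  then show ?thesis
  proof (rule continues_cong)
    fix n and t :: complex
    define u where "u = of_real (real n + 2) * weight 0 n t * of_real (mesh n) ^ k"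
    let ?z = "complex_of_real (mesh n)" and ?w = "complex_of_real (1 + mesh n)"
    have nz: "?w \<noteq> 0" using mesh_pos[of n] by (metis add_pos_pos of_real_eq_0_iff less_numeral_extra(3) zero_less_one)
    have wk: "weight k n t = u * ?z"
      by (subst weight_eq) (simp add: u_def)
    have Vn: "V n t = u * ((1 - ?z)\<^sup>2 * of_real (legendre_form x n))"
      by (simp add: V_def c_def u_def)
    have idx: "real (Suc n) + 2 = (real n + 2) * (1 + mesh n)"
      by (simp add: mesh_def field_simps)
    have m1: "1 - mesh (Suc n) = 1 / (1 + mesh n)"
      using mesh_pos[of n] by (simp add: mesh_Suc field_simps)
    have c': "c (Suc n) = mesh n ^ k * inverse (1 + mesh n) ^ k * inverse (1 + mesh n) ^ 2 * legendre_form x (Suc n)"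
      unfolding c_def m1 unfolding mesh_Suc by (simp add: divide_inverse power_mult_distrib)
    have "V (Suc n) t = u * (?w * weight_ratio 0 (mesh n) t * inverse ?w ^ k * inverse ?w ^ 2) * of_real (legendre_form x (Suc n))"
      unfolding V_def c' idx weight_shift u_def by (simp add: mult_ac)
    also have "?w * weight_ratio 0 (mesh n) t * inverse ?w ^ k * inverse ?w ^ 2 = weight_ratio (Suc k) (mesh n) t"
    proof -
      have wv: "?w * inverse ?w = 1" using nz by simp
      have "w * (w * E) * v ^ k * v ^ 2 = (w * v) * (w * v) * (v ^ k * E)" for w v E :: complex
        by (simp add: power2_eq_square mult_ac)
      moreover have "w * v ^ Suc k * E = (w * v) * (v ^ k * E)" for w v E :: complex
        by (simp add: mult_ac)
      moreover have "weight_ratio 0 (mesh n) t = ?w * exp (of_real (- 1 * mesh n) * t)"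
        "weight_ratio (Suc k) (mesh n) t = ?w * inverse ?w ^ Suc k * exp (of_real (- 1 * mesh n) * t)"
        by (simp_all add: weight_ratio_def)
      ultimately show ?thesis using wv by (simp only: mult_1_left)
    qed
    finally have V': "V (Suc n) t = u * weight_ratio (Suc k) (mesh n) t * of_real (legendre_form x (Suc n))" .
    show "V (Suc n) t - V n t = weight k n t *
           (G (mesh n) t * (1 - ?z)\<^sup>2 * of_real (legendre_form x n)
            + (1 + ?z * G (mesh n) t) * of_real (1 - x\<^sup>2) * (2 - ?z) * of_real (legendre_prod x x 0 n))"
      unfolding V' Vn wk G legendre_form_Suc
      by (simp add: legendre_prod_simps power2_eq_square algebra_simps)
  qed
qed

text \<open>
To leading order the telescope of \<open>diagonal_telescope\<close> is \<open>- (k + t) Q + 2 (1 - x\<^sup>2) A\<close> with \<open>A = P\<^sub>n\<^sub>+\<^sub>1\<^sup>2\<close>, while the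
relations of \<open>legendre_prod_relations\<close> at \<open>x = y\<close> reduce \<open>Q\<close> to \<open>2 (1 - x\<^sup>2) A\<close>. Together they leave
\<open>2 (1 - x\<^sup>2) (1 - k - t) A\<close>, and hence a possible simple pole at \<open>1 - k\<close>; the other products are multiples of \<open>A\<close>
up to lower order.
\<close>
lemma diagonal_step:
  fixes k :: nat
  defines "s \<equiv> 1 - of_nat k"
  assumes x: "\<bar>x\<bar> < 1" and P: "finite P" "s \<notin> P" and i: "i < 4"
    and lower: "\<forall>j<4. \<forall>F. (\<forall>d. expandable d F) \<longrightarrow>
      continues P N (\<lambda>n t. weight (Suc k) n t * F (mesh n) t * of_real (legendre_prod x x j n))"
  shows "continues (insert s P) N (\<lambda>n t. weight k n t * of_real (legendre_prod x x i n))"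
proof -
  have x1: "\<bar>x\<bar> \<le> 1" using x by simp
  have "x\<^sup>2 < 1" using x abs_square_less_1[of x] by simp
  then have c0: "complex_of_real (1 - x\<^sup>2) \<noteq> 0" by (metis of_real_eq_0_iff diff_gt_0_iff_gt less_irrefl)
  note rel = legendre_prod_relations[OF x1 x1 lower]
  obtain H where H: "\<And>d. expandable d H"
    "\<And>z t. z \<in> small_steps \<Longrightarrow>
       weight_ratio (Suc k) z t = 1 + of_real z * (1 - of_nat (Suc k) - t) + of_real z ^ 2 * H z t"
    using two_term_expansionD[OF two_term_expansion_weight_ratio[of "Suc k"]] by metis
  \<comment> \<open>\<open>F\<close> and \<open>F'\<close> collect what the coefficients of the form and of \<open>A\<close> in the telescope contain beyond their
    values \<open>g\<close> and \<open>2 (1 - x\<^sup>2)\<close> at \<open>z = 0\<close>, divided by \<open>z\<close>.\<close>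
  define g where "g t = - of_nat k - t" for t :: complex
  define G where "G z t = g t + of_real z * H z t" for z t
  define F where "F z t = H z t * (1 - of_real z)\<^sup>2 + g t * (of_real z - 2)" for z t
  define F' where "F' z t = of_real (1 - x\<^sup>2) * (2 * G z t - 1 - of_real z * G z t)" for z t
  have g: "g holomorphic_on UNIV" unfolding g_def by (intro holomorphic_intros)
  have G: "expandable d G" for d
    unfolding G_def by (intro expandable_intros g H)
  have F: "expandable d F" for d
    unfolding F_def by (intro expandable_intros holomorphic_intros g H)
  have F': "expandable d F'" for d
    unfolding F'_def by (intro expandable_intros holomorphic_intros G)
  have ratio: "weight_ratio (Suc k) (mesh n) t = 1 + of_real (mesh n) * G (mesh n) t" for n t
    using H(2)[OF mesh_small] by (simp add: G_def g_def power2_eq_square algebra_simps)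
  note tele = diagonal_telescope[OF x1 ratio, of P N]
  let ?X = "\<lambda>i n. complex_of_real (legendre_prod x x i n)"
  let ?low = "\<lambda>n t. weight (Suc k) n t * F (mesh n) t * ?X 0 n
      + (- 2 * of_real x) * (weight (Suc k) n t * F (mesh n) t * ?X 1 n)
      + weight (Suc k) n t * F (mesh n) t * ?X 3 n + weight (Suc k) n t * F' (mesh n) t * ?X 0 n"
  have low: "continues P N ?low"
    by (intro continues_add continues_cmult lower[rule_format] F F') auto
  have "continues P N (\<lambda>n t. (- 1 / (2 * of_real (1 - x\<^sup>2))) *
     (weight k n t *
           (G (mesh n) t * (1 - of_real (mesh n))\<^sup>2 * of_real (legendre_form x n)
            + (1 + of_real (mesh n) * G (mesh n) t) * of_real (1 - x\<^sup>2) * (2 - of_real (mesh n)) * ?X 0 n)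
      - ?low n t
      - g t * (of_real x * (weight k n t * of_real (2 * x * legendre_prod x x 0 n
                    - legendre_prod x x 2 n - legendre_prod x x 1 n)))
      + g t * (weight k n t * of_real (legendre_prod x x 0 n - legendre_prod x x 3 n))))"
    by (intro continues_cmult continues_add[OF continues_diff[OF continues_diff[OF tele low]]]
        continues_mult g rel)
  then have "continues P N (\<lambda>n t. (t - s) * (weight k n t * ?X 0 n))"
  proof (rule continues_cong)
    fix n and t :: complex
    define z where "z = complex_of_real (mesh n)"
    define q where "q = complex_of_real x"
    define A B D h e where "A = ?X 0 n" and "B = ?X 1 n" and "D = ?X 3 n"
      and "h = H (mesh n) t" and "e = g t"
    have se: "e = s - 1 - t" by (simp add: e_def g_def s_def)
    have key: "weight k n t * ((e + z * h) * (1 - z)\<^sup>2 * (A - 2 * q * B + D) + (1 + z * (e + z * h)) * (1 - q\<^sup>2) * (2 - z) * A)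
      - (z * weight k n t * (h * (1 - z)\<^sup>2 + e * (z - 2)) * A
          + (- 2 * q) * (z * weight k n t * (h * (1 - z)\<^sup>2 + e * (z - 2)) * B)
          + z * weight k n t * (h * (1 - z)\<^sup>2 + e * (z - 2)) * D
          + z * weight k n t * ((1 - q\<^sup>2) * (2 * (e + z * h) - 1 - z * (e + z * h))) * A)
      - e * (q * (weight k n t * (2 * q * A - B - B))) + e * (weight k n t * (A - D))
      = - (2 * (1 - q\<^sup>2)) * ((t - s) * (weight k n t * A))"
      unfolding se by algebra
    have c0': "1 - q\<^sup>2 \<noteq> 0" using c0 by (simp add: q_def)
    have cancel: "(- 1 / (2 * r)) * (- (2 * r) * w) = w" if "r \<noteq> 0" for r w :: complex
      using that by simp
    show "(- 1 / (2 * of_real (1 - x\<^sup>2))) *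
     (weight k n t *
           (G (mesh n) t * (1 - of_real (mesh n))\<^sup>2 * of_real (legendre_form x n)
            + (1 + of_real (mesh n) * G (mesh n) t) * of_real (1 - x\<^sup>2) * (2 - of_real (mesh n)) * ?X 0 n)
      - ?low n t
      - g t * (of_real x * (weight k n t * of_real (2 * x * legendre_prod x x 0 n
                    - legendre_prod x x 2 n - legendre_prod x x 1 n)))
      + g t * (weight k n t * of_real (legendre_prod x x 0 n - legendre_prod x x 3 n)))
      = (t - s) * (weight k n t * ?X 0 n)"
      unfolding legendre_form_eq_prods legendre_prod_sym F_def F'_def G_def weight_Suc_index
        of_real_add of_real_diff of_real_mult of_real_power of_real_1 of_real_numeral
        A_def[symmetric] B_def[symmetric] D_def[symmetric] z_def[symmetric] q_def[symmetric]
        h_def[symmetric] e_def[symmetric] key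
      by (rule cancel[OF c0'])
  qed
  then have A: "continues (insert s P) N (\<lambda>n t. weight k n t * ?X 0 n)"
    by (rule continues_divide[OF _ P(2,1)]) (simp add: s_def)
  have fin: "P \<subseteq> insert s P" "finite (insert s P)" using P by auto
  note rel' = rel[THEN continues_mono, OF fin]
  have D: "continues (insert s P) N (\<lambda>n t. weight k n t * ?X 3 n)"
    by (rule continues_cong[OF continues_diff[OF A rel'(4)]]) (simp_all add: algebra_simps)
  have B: "continues (insert s P) N (\<lambda>n t. weight k n t * ?X 1 n)"
    by (rule continues_cong[OF continues_diff[OF continues_cmult[OF A, of "of_real x"]
          continues_cmult[OF rel'(2), of "1 / 2"]]])
       (simp_all add: legendre_prod_sym algebra_simps)
  have C: "continues (insert s P) N (\<lambda>n t. weight k n t * ?X 2 n)"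
    using B by (simp add: legendre_prod_sym)
  show ?thesis using i A B C D unfolding less_4 by auto
qed

text \<open>
Stage \<open>j\<close> of the induction contributes the possible pole \<open>1 - j\<close> in the interior (\<open>e = 1\<close>) and \<open>2 - 2 j\<close> at the
end points (\<open>e = 2\<close>).
\<close>
definition lattice_points :: "nat \<Rightarrow> nat set \<Rightarrow> complex set" where
  "lattice_points e J = (\<lambda>j. of_nat e * (1 - of_nat j)) ` J"

lemma finite_lattice_points: "finite J \<Longrightarrow> finite (lattice_points e J)"
  by (simp add: lattice_points_def)

lemma lattice_points_notin:
  assumes "k \<notin> J" "e > 0"
  shows "of_nat e * (1 - of_nat k) \<notin> lattice_points e J"
  using assms by (auto simp: lattice_points_def)

lemma lattice_points_insert:
  assumes "k < M"
  shows "lattice_points e {k..<M} = insert (of_nat e * (1 - of_nat k)) (lattice_points e {Suc k..<M})"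
proof -
  have "{k..<M} = insert k {Suc k..<M}" using assms by auto
  then show ?thesis by (simp add: lattice_points_def)
qed

lemma continues_diagonal:
  assumes x: "\<bar>x\<bar> < 1"
  shows "k + d = N + 3 \<Longrightarrow> i < 4 \<Longrightarrow> expandable d F \<Longrightarrow>
    continues (lattice_points 1 {k..<N + 3}) N
      (\<lambda>n t. weight k n t * F (mesh n) t * of_real (legendre_prod x x i n))"
proof (induction d arbitrary: k i F)
  case 0
  then show ?case
    using continues_base[of F "legendre_prod x x i" 1] abs_legendre_prod_le[of x x i] x
    by (simp add: lattice_points_def)
next
  case (Suc d)
  let ?P = "lattice_points 1 {Suc k..<N + 3}"
  have eq: "lattice_points 1 {k..<N + 3} = insert (1 - of_nat k) ?P"
    using lattice_points_insert[of k "N + 3" 1] Suc.prems(1) by simp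
  have fin: "finite ?P" by (simp add: finite_lattice_points)
  have notin: "1 - of_nat k \<notin> ?P" using lattice_points_notin[of k "{Suc k..<N + 3}" 1] by simp
  have lower: "continues ?P N (\<lambda>n t. weight (Suc k) n t * G (mesh n) t * of_real (legendre_prod x x j n))"
    if "j < 4" "expandable d G" for j G
    using Suc.IH[of "Suc k" j G] Suc.prems(1) that by simp
  have pure: "continues (insert (1 - of_nat k) ?P) N (\<lambda>n t. weight k n t * of_real (legendre_prod x x i n))"
    by (rule diagonal_step[OF x fin notin Suc.prems(2)]) (use lower in auto)
  have "continues (insert (1 - of_nat k) ?P) N (\<lambda>n t. weight (Suc k) n t * G (mesh n) t * of_real (legendre_prod x x i n))"
    if "expandable d G" for G
    by (rule continues_mono[OF lower[OF Suc.prems(2) that]]) (use fin in auto)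
  then show ?case
    unfolding eq by (rule continues_expandable_Suc[OF pure _ Suc.prems(3)])
qed

lemma continues_cancel:
  assumes "continues P N f" "finite P" "s \<in> P"
  shows "continues (P - {s}) N (\<lambda>n t. (t - s) * f n t)"
proof -
  obtain F where F: "F holomorphic_on {t. Re t > - real N}"
      "\<And>t. Re t > 2 \<Longrightarrow> (\<Prod>s\<in>P. t - s) * (\<Sum>n. f n t) = F t"
    using assms(1) by (auto simp: continues_def)
  show ?thesis
    unfolding continues_def
  proof (intro conjI exI[of _ F] allI impI)
    fix t :: complex assume t: "Re t > 2"
    have "(\<Prod>s\<in>P - {s}. t - s) * (\<Sum>n. (t - s) * f n t) = (\<Prod>s\<in>P. t - s) * (\<Sum>n. f n t)"
      using suminf_mult[OF continues_summable[OF assms(1) t], of "t - s"]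
        prod.remove[OF assms(2,3), of "\<lambda>s. t - s"] by simp
    then show "(\<Prod>s\<in>P - {s}. t - s) * (\<Sum>n. (t - s) * f n t) = F t" using F(2)[OF t] by simp
  qed (auto intro!: F summable_mult continues_summable[OF assms(1)])
qed

text \<open>
Needed to extract the factor \<open>t\<close> from \<open>1 - exp (- t z)\<close> by an entire cofactor.
\<close>
lemma exp_minus_1_factor:
  obtains \<phi> :: "complex \<Rightarrow> complex" where "\<phi> holomorphic_on UNIV" "\<And>w. exp w = 1 + w * \<phi> w"
proof -
  have "exp holomorphic_on (UNIV :: complex set)" by (intro holomorphic_intros)
  from entire_factor[OF this] show ?thesis using that by (metis exp_zero)
qed

lemma lattice_points_0: "1 < M \<Longrightarrow> 0 \<in> lattice_points e {0..<M}"
  by (auto simp: lattice_points_def intro!: image_eqI[of _ _ 1])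

text \<open>
The coefficients of the series are the increments of \<open>(n + 1)\<^sup>2 S\<^sub>n\<close>. Passing to the differences of the
weights brings in \<open>1 - exp (- t z)\<close>, which vanishes at \<open>t = 0\<close>.
\<close>
lemma K2_term_summation_by_parts:
  fixes S :: "nat \<Rightarrow> real"
  assumes S: "\<And>n. (real n + 2) ^ 2 * S (Suc n) - (real n + 1) ^ 2 * S n = (real n + 3 / 2) * legendre (Suc n) x ^ 2"
    and bound: "\<And>n. \<bar>S n\<bar> \<le> B"
    and rest: "continues P N (\<lambda>n t. of_real ((real n + 2) * S (Suc n)) * weight 0 n t * (1 - exp (- of_real (mesh n) * t)))"
  shows "continues P N (\<lambda>n t. K2_term t x x (Suc n))"
proof -
  define c where "c n = (1 - mesh n) ^ 2 * S n" for n
  define V where "V n t = of_real (real n + 2) * weight 0 n t * of_real (c n)" for n t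
  have "continues P N (\<lambda>n t. V (Suc n) t - V n t)"
  proof (rule continues_telescope)
    show "V 0 holomorphic_on UNIV"
      unfolding V_def[abs_def] by (intro holomorphic_intros weight_holomorphic)
    fix t :: complex assume t: "Re t > 2"
    have "\<bar>c n\<bar> \<le> 1 * B" for n
      unfolding c_def abs_mult using bound[of n] mesh_nonneg[of n] mesh_le[of n]
      by (intro mult_mono) (auto intro!: power_le_one)
    from weight_tendsto_0[OF t this] show "(\<lambda>n. V n t) \<longlonglongrightarrow> 0"
      unfolding V_def .
  qed
  from continues_add[OF this rest] show ?thesis
  proof (rule continues_cong)
    fix n and t :: complex
    let ?E = "exp (- t * harm (Suc n))" and ?e = "exp (- of_real (mesh n) * t)"
    have n: "(real n + 2) * (1 - mesh n) = real n + 1"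
      using mesh_mult[of n] by (simp add: algebra_simps)
    have n': "(real (Suc n) + 2) * (1 - mesh (Suc n)) = real n + 2"
      using mesh_mult[of "Suc n"] by (simp add: algebra_simps)
    have V: "V m t = of_real ((real m + 2) ^ 2 * c m) * exp (- t * harm (Suc m))" for m
      by (simp add: V_def weight_def power2_eq_square)
    have Vn: "V n t = of_real ((real n + 1) ^ 2 * S n) * ?E"
      unfolding V c_def mult.assoc[symmetric] power_mult_distrib[symmetric] n ..
    have "exp (- t * harm (Suc (Suc n))) = ?E * ?e"
      by (simp add: harm_Suc[of "Suc n"] mesh_def exp_add[symmetric] field_simps)
    then have V': "V (Suc n) t = of_real ((real n + 2) ^ 2 * S (Suc n)) * (?E * ?e)"
      unfolding V c_def mult.assoc[symmetric] power_mult_distrib[symmetric] n' by (simp add: mult.assoc)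
    have K: "K2_term t x x (Suc n) = of_real ((real n + 3 / 2) * legendre (Suc n) x ^ 2) * ?E"
      by (simp add: K2_term_def legendre_def power2_eq_square field_simps)
    have "V (Suc n) t - V n t + of_real ((real n + 2) ^ 2 * S (Suc n)) * ?E * (1 - ?e) =
        of_real ((real n + 2) ^ 2 * S (Suc n) - (real n + 1) ^ 2 * S n) * ?E"
      unfolding V' Vn of_real_diff by (simp add: algebra_simps)
    then show "V (Suc n) t - V n t + of_real ((real n + 2) * S (Suc n)) * weight 0 n t * (1 - ?e)
        = K2_term t x x (Suc n)"
      unfolding S K by (simp add: weight_def power2_eq_square mult_ac)
  qed
qed

text \<open>
The rest term left by \<open>K2_term_summation_by_parts\<close> is \<open>t\<close> times a series to which \<open>continues_diagonal\<close> applies, so the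
candidate \<open>0\<close> is cancelled.
\<close>
lemma continues_K2_interior:
  assumes x: "\<bar>x\<bar> < 1"
  shows "continues (lattice_points 1 {0..<N + 3} - {0}) N (\<lambda>n t. K2_term t x x (Suc n))"
proof -
  have x1: "\<bar>x\<bar> \<le> 1" using x by simp
  have c0: "1 - x\<^sup>2 > 0" using x abs_square_less_1[of x] by simp
  obtain \<phi> :: "complex \<Rightarrow> complex" where \<phi>: "\<phi> holomorphic_on UNIV" "\<And>w. exp w = 1 + w * \<phi> w"
    using exp_minus_1_factor by blast
  define \<psi> where "\<psi> z t = \<phi> (of_real (- 1 * z) * t)" for z t
  have \<psi>: "expandable d \<psi>" for d
    unfolding \<psi>_def by (intro expandable_entire \<phi>)
  define a b :: "real \<Rightarrow> complex \<Rightarrow> complex" where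
    "a z t = \<psi> z t * (1 - of_real z) ^ 2" and
    "b z t = \<psi> z t * (of_real (1 - x\<^sup>2) * of_real z * (2 - of_real z))" for z t
  have ab: "expandable d a" "expandable d b" for d
    unfolding a_def b_def by (intro expandable_intros \<psi> holomorphic_intros)+
  let ?P = "lattice_points 1 {0..<N + 3}"
  let ?X = "\<lambda>i n. complex_of_real (legendre_prod x x i n)"
  have base: "continues ?P N (\<lambda>n t. weight 0 n t * F (mesh n) t * ?X i n)"
    if "expandable (N + 3) F" "i < 4" for F i
    using continues_diagonal[OF x, of 0 "N + 3" N i F] that by simp
  define R where "R n t = of_real (1 / (2 * (1 - x\<^sup>2))) *
     (weight 0 n t * a (mesh n) t * ?X 0 n + (- 2 * of_real x) * (weight 0 n t * a (mesh n) t * ?X 1 n)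
      + weight 0 n t * a (mesh n) t * ?X 3 n + weight 0 n t * b (mesh n) t * ?X 0 n)" for n t
  have "continues ?P N R"
    unfolding R_def by (intro continues_add continues_cmult base ab) simp_all
  from continues_cancel[OF this, of 0]
  have R: "continues (?P - {0}) N (\<lambda>n t. t * R n t)"
    by (simp add: finite_lattice_points lattice_points_0)
  show ?thesis
  proof (rule K2_term_summation_by_parts[where S = "\<lambda>n. legendre_form x n / (2 * (1 - x\<^sup>2))"
        and B = "1 / 2"])
    fix n
    have n: "(real n + 2) * (1 - mesh n) = real n + 1" "(real n + 2) * (2 - mesh n) = 2 * real n + 3"
      using mesh_mult[of n] by (simp_all add: algebra_simps)
    have "(real n + 2) ^ 2 * legendre_form x (Suc n) = ((real n + 2) * (1 - mesh n)) ^ 2 * legendre_form x n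
       + (1 - x\<^sup>2) * ((real n + 2) * mesh n) * ((real n + 2) * (2 - mesh n)) * legendre (Suc n) x ^ 2"
      unfolding legendre_form_Suc by algebra
    then have "(real n + 2) ^ 2 * legendre_form x (Suc n) - (real n + 1) ^ 2 * legendre_form x n
        = (1 - x\<^sup>2) * (2 * real n + 3) * legendre (Suc n) x ^ 2"
      unfolding n mesh_mult by simp
    then have "((real n + 2) ^ 2 * legendre_form x (Suc n) - (real n + 1) ^ 2 * legendre_form x n) / (2 * (1 - x\<^sup>2))
        = (1 - x\<^sup>2) * (2 * real n + 3) * legendre (Suc n) x ^ 2 / (2 * (1 - x\<^sup>2))" by (rule arg_cong)
    also have "\<dots> = (real n + 3 / 2) * legendre (Suc n) x ^ 2"
      using c0 by (simp add: field_simps)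
    finally show "(real n + 2)\<^sup>2 * (legendre_form x (Suc n) / (2 * (1 - x\<^sup>2))) -
         (real n + 1)\<^sup>2 * (legendre_form x n / (2 * (1 - x\<^sup>2))) = (real n + 3 / 2) * (legendre (Suc n) x)\<^sup>2"
      by (simp add: diff_divide_distrib)
    show "\<bar>legendre_form x n / (2 * (1 - x\<^sup>2))\<bar> \<le> 1 / 2"
      using legendre_form_le[of x n] legendre_form_nonneg[OF x1, of n] c0 by (simp add: field_simps)
  next
    show "continues (?P - {0}) N (\<lambda>n t. of_real ((real n + 2) * (legendre_form x (Suc n) / (2 * (1 - x\<^sup>2))))
       * weight 0 n t * (1 - exp (- of_real (mesh n) * t)))"
    proof (rule continues_cong[OF R])
      fix n and t :: complex
      let ?z = "complex_of_real (mesh n)"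
      have e: "1 - exp (- ?z * t) = ?z * t * \<psi> (mesh n) t"
        by (subst \<phi>(2)) (simp add: \<psi>_def)
      have nz: "complex_of_real (real n + 2) * ?z = 1"
        using mesh_mult[of n] by (metis of_real_1 of_real_mult)
      have "legendre_form x (Suc n) = (1 - mesh n)\<^sup>2 *
            (legendre_prod x x 0 n - 2 * x * legendre_prod x x 1 n + legendre_prod x x 3 n)
          + (1 - x\<^sup>2) * mesh n * (2 - mesh n) * legendre_prod x x 0 n"
        unfolding legendre_form_Suc legendre_form_eq_prods[of x n]
        by (simp add: legendre_prod_simps power2_eq_square)
      then have form: "complex_of_real (legendre_form x (Suc n)) =
          (1 - ?z)\<^sup>2 * (?X 0 n - 2 * of_real x * ?X 1 n + ?X 3 n) + of_real (1 - x\<^sup>2) * ?z * (2 - ?z) * ?X 0 n"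
        by simp
      have "of_real ((real n + 2) * (legendre_form x (Suc n) / (2 * (1 - x\<^sup>2)))) * weight 0 n t * (1 - exp (- ?z * t))
         = (complex_of_real (real n + 2) * ?z) * (of_real (1 / (2 * (1 - x\<^sup>2))) * weight 0 n t * t * \<psi> (mesh n) t
            * complex_of_real (legendre_form x (Suc n)))"
        unfolding e by (simp add: mult_ac)
      also have "\<dots> = t * R n t"
        unfolding nz form R_def a_def b_def by (simp add: algebra_simps)
      finally show "t * R n t = of_real ((real n + 2) * (legendre_form x (Suc n) / (2 * (1 - x\<^sup>2))))
       * weight 0 n t * (1 - exp (- of_real (mesh n) * t))" ..
    qed
  qed
qed


section \<open>The diagonal at the end points of the interval\<close>
definition even_family :: "(real \<Rightarrow> complex \<Rightarrow> complex) \<Rightarrow> bool" where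
  "even_family F \<longleftrightarrow> (\<forall>z t. F (- z) t = F z t)"

text \<open>
Averaging the expansion over \<open>z\<close> and \<open>- z\<close> removes the odd coefficients.
\<close>
lemma expandable_even_Suc:
  assumes F: "expandable (Suc (Suc d)) F" and even: "even_family F"
  obtains a G where "a holomorphic_on UNIV" "expandable d G" "even_family G"
    "\<And>z t. z \<in> small_steps \<Longrightarrow> F z t = a t + of_real z ^ 2 * G z t"
proof -
  obtain a F1 where a: "a holomorphic_on UNIV" "expandable (Suc d) F1"
      "\<And>z t. z \<in> small_steps \<Longrightarrow> F z t = a t + of_real z * F1 z t"
    using F by (metis expandable.simps(2))
  obtain b F2 where b: "b holomorphic_on UNIV" "expandable d F2"
      "\<And>z t. z \<in> small_steps \<Longrightarrow> F1 z t = b t + of_real z * F2 z t"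
    using a(2) by auto
  define G where "G z t = (1 / 2) * (F2 z t + F2 (- z) t)" for z t
  show ?thesis
  proof
    show "a holomorphic_on UNIV" by fact
    show "expandable d G"
      unfolding G_def by (intro expandable_mult[OF expandable_const] expandable_add b(2) expandable_reflect) auto
    show "even_family G" by (simp add: even_family_def G_def add.commute)
    fix z t assume z: "z \<in> small_steps"
    have "F z t = (F z t + F (- z) t) / 2" using even by (simp add: even_family_def)
    also have "\<dots> = a t + of_real z ^ 2 * G z t"
      using z by (simp add: a(3) b(3) G_def power2_eq_square algebra_simps)
    finally show "F z t = a t + of_real z ^ 2 * G z t" .
  qed
qed

text \<open>
Multiplying \<open>W\<^sub>n\<close> by this factor gives the geometric mean of \<open>W\<^sub>n\<close> and \<open>W\<^sub>n\<^sub>+\<^sub>1\<close>, the weight about which the summation by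
parts is symmetric.
\<close>
definition half_shift :: "real \<Rightarrow> complex \<Rightarrow> complex" where
  "half_shift z t = exp (of_real (- 1 / 2 * z) * t)"

text \<open>
The ratio of \<open>W\<^sub>n\<^sub>+\<^sub>1 (n + 5/2)\<^sup>c\<close> to the mean weight times \<open>(n + 2)\<^sup>c\<close>, where \<open>c = 2 - 2 k\<close>. Reflecting \<open>z\<close>
gives the same ratio for \<open>W\<^sub>n (n + 3/2)\<^sup>c\<close>.
\<close>
definition midpoint_power :: "nat \<Rightarrow> real \<Rightarrow> complex \<Rightarrow> complex" where
  "midpoint_power k z t =
     half_shift z t * (1 + of_real (1 / 2 * z)) ^ 2 * inverse (1 + of_real (1 / 2 * z)) ^ (2 * k)"

lemma two_term_expansion_midpoint_power:
  "two_term_expansion (midpoint_power k) (\<lambda>_. 1) (\<lambda>t. 1 - of_nat k - t / 2)"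
proof -
  have "two_term_expansion (midpoint_power k) (\<lambda>t. (1 * 1) * 1)
     (\<lambda>t. (1 * 1) * (of_nat (2 * k) * (- of_real (1 / 2))) + (1 * (of_nat 2 * of_real (1 / 2)) + of_real (- 1 / 2) * t * 1) * 1)"
    unfolding midpoint_power_def[abs_def] half_shift_def
    by (intro two_term_expansion_mult two_term_expansion_one_plus two_term_expansion_power
        two_term_expansion_inverse_one_plus two_term_expansion_exp) auto
  then show ?thesis by (simp add: algebra_simps)
qed

text \<open>
The telescope is \<open>W\<^sub>n (n + 3/2)\<^sup>c\<close> with \<open>c = 2 - 2 k\<close>.
\<close>
lemma midpoint_telescope:
  "continues P N (\<lambda>n t. of_real (real n + 2) * weight (2 * k) n t * half_shift (mesh n) t *
      (midpoint_power k (mesh n) t - midpoint_power k (- mesh n) t))"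
proof -
  define c where "c n = mesh n ^ (2 * k) * ((1 - mesh n / 2) ^ 2 * inverse (1 - mesh n / 2) ^ (2 * k))" for n
  define V where "V n t = of_real (real n + 2) * weight 0 n t * of_real (c n)" for n t
  have "continues P N (\<lambda>n t. V (Suc n) t - V n t)"
  proof (rule continues_telescope)
    show "V 0 holomorphic_on UNIV"
      unfolding V_def[abs_def] by (intro holomorphic_intros weight_holomorphic)
    fix t :: complex assume t: "Re t > 2"
    have "\<bar>c n\<bar> \<le> 1 * (1 * 2 ^ (2 * k))" for n
    proof -
      have "inverse (1 - mesh n / 2) \<le> inverse (1 / 2)"
        using mesh_le[of n] by (intro le_imp_inverse_le) auto
      then have "\<bar>inverse (1 - mesh n / 2)\<bar> \<le> 2" using mesh_le[of n] by simp
      then show ?thesis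
        unfolding c_def abs_mult power_abs using mesh_nonneg[of n] mesh_le[of n]
        by (intro mult_mono power_mono) (auto intro!: power_le_one)
    qed
    from weight_tendsto_0[OF t this] show "(\<lambda>n. V n t) \<longlonglongrightarrow> 0"
      unfolding V_def .
  qed
  then show ?thesis
  proof (rule continues_cong)
    fix n and t :: complex
    define u where "u = of_real (real n + 2) * weight (2 * k) n t"
    let ?z = "complex_of_real (mesh n)"
    have nz: "1 + mesh n \<noteq> 0" using mesh_pos[of n] by linarith
    have idx: "real (Suc n) + 2 = (real n + 2) * (1 + mesh n)"
      by (simp add: mesh_def field_simps)
    have half: "1 - mesh (Suc n) / 2 = (1 + mesh n / 2) / (1 + mesh n)"
      using nz by (simp add: mesh_Suc field_simps)
    have c': "c (Suc n) * (1 + mesh n) ^ 2 = mesh n ^ (2 * k) * ((1 + mesh n / 2) ^ 2 * inverse (1 + mesh n / 2) ^ (2 * k))"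
    proof -
      have "c (Suc n) * (1 + mesh n) ^ 2 = (mesh n * ((1 + mesh n) / (1 + mesh n))) ^ (2 * k)
          * (((1 + mesh n / 2) * ((1 + mesh n) / (1 + mesh n))) ^ 2 * inverse (1 + mesh n / 2) ^ (2 * k))"
        unfolding c_def half unfolding mesh_Suc
        by (simp only: divide_inverse power_mult_distrib inverse_mult_distrib inverse_inverse_eq mult_ac)
      then show ?thesis using nz by simp
    qed
    have e: "weight_ratio 0 (mesh n) t = of_real (1 + mesh n) * (half_shift (mesh n) t * half_shift (mesh n) t)"
      by (simp add: weight_ratio_def half_shift_def exp_add[symmetric] field_simps)
    have e': "half_shift (mesh n) t * half_shift (- mesh n) t = 1"
      by (simp add: half_shift_def exp_add[symmetric])
    have V: "V n t = u * ((1 - ?z / 2) ^ 2 * inverse (1 - ?z / 2) ^ (2 * k))"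
      unfolding V_def u_def c_def weight_eq_weight_0[of "2 * k"] by (simp add: mult_ac)
    have "V (Suc n) t = of_real (real n + 2) * weight 0 n t * (half_shift (mesh n) t * half_shift (mesh n) t)
        * of_real (c (Suc n) * (1 + mesh n) ^ 2)"
      unfolding V_def idx weight_shift e of_real_mult of_real_power by (simp add: power2_eq_square mult_ac)
    then have V': "V (Suc n) t = u * (half_shift (mesh n) t * half_shift (mesh n) t)
        * ((1 + ?z / 2) ^ 2 * inverse (1 + ?z / 2) ^ (2 * k))"
      unfolding c' u_def weight_eq_weight_0[of "2 * k"] by (simp add: mult_ac)
    have "u * half_shift (mesh n) t * (midpoint_power k (mesh n) t - midpoint_power k (- mesh n) t)
       = u * (half_shift (mesh n) t * half_shift (mesh n) t) * ((1 + ?z / 2) ^ 2 * inverse (1 + ?z / 2) ^ (2 * k))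
        - u * (half_shift (mesh n) t * half_shift (- mesh n) t) * ((1 - ?z / 2) ^ 2 * inverse (1 - ?z / 2) ^ (2 * k))"
      by (simp add: midpoint_power_def right_diff_distrib mult_ac)
    then show "V (Suc n) t - V n t = of_real (real n + 2) * weight (2 * k) n t * half_shift (mesh n) t *
      (midpoint_power k (mesh n) t - midpoint_power k (- mesh n) t)"
      unfolding V V' e' by (simp add: u_def)
  qed
qed

lemma weight_double_Suc: "weight (2 * Suc k) n t = of_real (mesh n) ^ 2 * weight (2 * k) n t"
  by (simp add: weight_def power2_eq_square)

text \<open>
The telescope of \<open>midpoint_telescope\<close> is odd in \<open>z\<close>. After division by \<open>z\<close> its expansion is even with leading coefficient
\<open>2 - 2 k - t\<close>, so that one step gains two powers of \<open>z\<close>.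
\<close>
lemma endpoint_step:
  fixes k :: nat
  defines "s \<equiv> 2 * (1 - of_nat k)"
  assumes P: "finite P" "s \<notin> P"
    and lower: "\<And>G. (\<And>d. expandable d G) \<Longrightarrow> even_family G \<Longrightarrow>
      continues P N (\<lambda>n t. weight (2 * Suc k) n t * half_shift (mesh n) t * G (mesh n) t)"
  shows "continues (insert s P) N (\<lambda>n t. weight (2 * k) n t * half_shift (mesh n) t)"
proof -
  obtain H where H: "\<And>d. expandable d H"
    "\<And>z t. z \<in> small_steps \<Longrightarrow>
       midpoint_power k z t = 1 + of_real z * (1 - of_nat k - t / 2) + of_real z ^ 2 * H z t"
    using two_term_expansionD[OF two_term_expansion_midpoint_power[of k]] by metis
  define G where "G z t = (H z t - H (- z) t) / of_real z" for z t
  have G: "expandable d G" for d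
  proof -
    obtain b H1 where b: "b holomorphic_on UNIV" "expandable d H1"
        "\<And>z t. z \<in> small_steps \<Longrightarrow> H z t = b t + of_real z * H1 z t"
      using H(1)[of "Suc d"] by auto
    have "expandable d (\<lambda>z t. H1 z t + H1 (- z) t)"
      by (intro expandable_add expandable_reflect b)
    then show ?thesis
    proof (rule expandable_cong)
      fix z t assume "z \<in> small_steps"
      then show "H1 z t + H1 (- z) t = G z t"
        by (simp add: G_def b(3)) (simp add: small_steps_def field_simps)
    qed
  qed
  have even: "even_family G"
    unfolding even_family_def G_def by (simp add: divide_simps)
  note tele = midpoint_telescope[of P N k]
  have "continues P N (\<lambda>n t. weight (2 * Suc k) n t * half_shift (mesh n) t * G (mesh n) t
     - of_real (real n + 2) * weight (2 * k) n t * half_shift (mesh n) t *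
      (midpoint_power k (mesh n) t - midpoint_power k (- mesh n) t))"
    by (intro continues_diff tele lower G even)
  then have "continues P N (\<lambda>n t. (t - s) * (weight (2 * k) n t * half_shift (mesh n) t))"
  proof (rule continues_cong)
    fix n and t :: complex
    let ?z = "complex_of_real (mesh n)"
    have nz: "complex_of_real (real n + 2) * ?z = 1"
      using mesh_mult[of n] by (metis of_real_1 of_real_mult)
    have z0: "?z \<noteq> 0" using mesh_pos[of n] by simp
    have m: "- mesh n \<in> small_steps" using mesh_small by simp
    have "midpoint_power k (mesh n) t - midpoint_power k (- mesh n) t = ?z * ((s - t) + ?z ^ 2 * G (mesh n) t)"
      unfolding H(2)[OF mesh_small] H(2)[OF m] G_def s_def
      using z0 by (simp add: power2_eq_square field_simps)
    then have "of_real (real n + 2) * weight (2 * k) n t * half_shift (mesh n) t *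
        (midpoint_power k (mesh n) t - midpoint_power k (- mesh n) t)
      = (complex_of_real (real n + 2) * ?z) * (weight (2 * k) n t * half_shift (mesh n) t * ((s - t) + ?z ^ 2 * G (mesh n) t))"
      by (simp add: mult_ac)
    then show "weight (2 * Suc k) n t * half_shift (mesh n) t * G (mesh n) t
     - of_real (real n + 2) * weight (2 * k) n t * half_shift (mesh n) t *
        (midpoint_power k (mesh n) t - midpoint_power k (- mesh n) t)
      = (t - s) * (weight (2 * k) n t * half_shift (mesh n) t)"
      unfolding nz weight_double_Suc by (simp add: algebra_simps)
  qed
  then show ?thesis
    by (rule continues_divide[OF _ P(2,1)]) (simp add: s_def)
qed

lemma continues_endpoint:
  "k + d = N + 3 \<Longrightarrow> expandable (2 * d) F \<Longrightarrow> even_family F \<Longrightarrow>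
    continues (lattice_points 2 {k..<N + 3}) N
      (\<lambda>n t. weight (2 * k) n t * half_shift (mesh n) t * F (mesh n) t)"
proof (induction d arbitrary: k F)
  case 0
  then have k: "k = N + 3" and F: "bounded_family F" by auto
  have "bounded_family (\<lambda>z t. of_real z ^ (N + 3) * (half_shift z t * F z t))"
    using expandable_power[OF expandable_id, of 0 "N + 3"] expandable_exp[of 0 "- 1 / 2"] F
    unfolding half_shift_def by (intro bounded_family_mult) simp_all
  from continues_base[OF this, of "\<lambda>_. 1" 1 "{}" N]
  have "continues {} N (\<lambda>n t. weight (2 * (N + 3)) n t * half_shift (mesh n) t * F (mesh n) t)"
  proof (rule continues_cong)
    have "weight (j + k) n t = of_real (mesh n) ^ j * weight k n t" for j k n t
      by (simp add: weight_def power_add)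
    then show "weight (N + 3) n t * (of_real (mesh n) ^ (N + 3) * (half_shift (mesh n) t * F (mesh n) t)) * of_real 1
        = weight (2 * (N + 3)) n t * half_shift (mesh n) t * F (mesh n) t" for n t
      by (simp only: mult_2 of_real_1 mult_1_right mult_1_left mult_ac)
  qed simp
  then show ?case by (simp add: k lattice_points_def)
next
  case (Suc d)
  let ?P = "lattice_points 2 {Suc k..<N + 3}" and ?s = "2 * (1 - of_nat k)"
  have eq: "lattice_points 2 {k..<N + 3} = insert ?s ?P"
    using lattice_points_insert[of k "N + 3" 2] Suc.prems(1) by simp
  have fin: "finite ?P" by (simp add: finite_lattice_points)
  have notin: "?s \<notin> ?P" using lattice_points_notin[of k "{Suc k..<N + 3}" 2] by simp
  have lower: "continues ?P N (\<lambda>n t. weight (2 * Suc k) n t * half_shift (mesh n) t * G (mesh n) t)"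
    if "expandable (2 * d) G" "even_family G" for G
    using Suc.IH[of "Suc k" G] Suc.prems(1) that by simp
  have pure: "continues (insert ?s ?P) N (\<lambda>n t. weight (2 * k) n t * half_shift (mesh n) t)"
    by (rule endpoint_step[OF fin notin lower])
  obtain a G where aG: "a holomorphic_on UNIV" "expandable (2 * d) G" "even_family G"
      "\<And>z t. z \<in> small_steps \<Longrightarrow> F z t = a t + of_real z ^ 2 * G z t"
    using expandable_even_Suc[of "2 * d" F] Suc.prems(2,3) by (metis mult_Suc_right numeral_2_eq_2 add_Suc add_0)
  have low: "continues (insert ?s ?P) N (\<lambda>n t. weight (2 * Suc k) n t * half_shift (mesh n) t * G (mesh n) t)"
    by (rule continues_mono[OF lower[OF aG(2,3)]]) (use fin in auto)
  show ?case
    unfolding eq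
    by (rule continues_cong[OF continues_add[OF continues_mult[OF pure aG(1)] low]])
       (simp only: aG(4)[OF mesh_small] weight_double_Suc, simp only: algebra_simps)
qed

text \<open>
The increments of the weight are the mean weight times \<open>2 sinh (t z / 2)\<close>, which is \<open>t z\<close> times an even family.
\<close>
lemma continues_K2_endpoint:
  assumes x: "\<bar>x\<bar> = 1"
  shows "continues (lattice_points 2 {0..<N + 3} - {0}) N (\<lambda>n t. K2_term t x x (Suc n))"
proof -
  obtain \<phi> :: "complex \<Rightarrow> complex" where \<phi>: "\<phi> holomorphic_on UNIV" "\<And>w. exp w = 1 + w * \<phi> w"
    using exp_minus_1_factor by blast
  define m where "m z t = (1 / 4) * (\<phi> (of_real (1 / 2 * z) * t) + \<phi> (of_real (- 1 / 2 * z) * t))" for z t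
  have m: "expandable d m" for d
    unfolding m_def by (intro expandable_mult[OF expandable_const] expandable_add expandable_entire \<phi>) auto
  have even: "even_family m" by (simp add: even_family_def m_def add.commute)
  let ?P = "lattice_points 2 {0..<N + 3}"
  have "continues ?P N (\<lambda>n t. weight (2 * 0) n t * half_shift (mesh n) t * m (mesh n) t)"
    by (rule continues_endpoint[OF _ m even, of 0 "N + 3"]) simp
  from continues_cancel[OF this, of 0]
  have R: "continues (?P - {0}) N (\<lambda>n t. t * (weight 0 n t * half_shift (mesh n) t * m (mesh n) t))"
    by (simp add: finite_lattice_points lattice_points_0)
  have sq: "legendre n x ^ 2 = 1" for n
  proof -
    have "x = 1 \<or> x = -1" using x by linarith
    then show ?thesis by (auto simp: legendre_endpoint power_mult[symmetric])
  qed
  show ?thesis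
  proof (rule K2_term_summation_by_parts[where S = "\<lambda>_. 1 / 2" and B = "1 / 2"])
    show "continues (?P - {0}) N (\<lambda>n t. of_real ((real n + 2) * (1 / 2)) * weight 0 n t
        * (1 - exp (- of_real (mesh n) * t)))"
    proof (rule continues_cong[OF R])
      fix n and t :: complex
      let ?z = "complex_of_real (mesh n)"
      have nz: "complex_of_real (real n + 2) * ?z = 1"
        using mesh_mult[of n] by (metis of_real_1 of_real_mult)
      have "1 - exp (- ?z * t) = half_shift (mesh n) t * (exp (of_real (1 / 2 * mesh n) * t) - exp (of_real (- 1 / 2 * mesh n) * t))"
        by (simp add: half_shift_def right_diff_distrib exp_add[symmetric]) (simp add: mult.commute)
      also have "exp (of_real (1 / 2 * mesh n) * t) - exp (of_real (- 1 / 2 * mesh n) * t) = 2 * ?z * t * m (mesh n) t"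
        unfolding \<phi>(2)[of "of_real (1 / 2 * mesh n) * t"] \<phi>(2)[of "of_real (- 1 / 2 * mesh n) * t"] m_def
        by (simp add: algebra_simps)
      finally have e: "1 - exp (- ?z * t) = half_shift (mesh n) t * (2 * ?z * t * m (mesh n) t)" .
      have "of_real ((real n + 2) * (1 / 2)) * weight 0 n t * (1 - exp (- ?z * t)) =
         (complex_of_real (real n + 2) * ?z) * (t * (weight 0 n t * half_shift (mesh n) t * m (mesh n) t))"
        unfolding e by (simp add: mult_ac)
      then show "t * (weight 0 n t * half_shift (mesh n) t * m (mesh n) t) =
         of_real ((real n + 2) * (1 / 2)) * weight 0 n t * (1 - exp (- ?z * t))"
        unfolding nz mult_1_left by (rule sym)
    qed
  qed (simp_all add: sq, simp add: power2_eq_square algebra_simps)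
qed


section \<open>The leading pole on the diagonal\<close>
lemma legendre_form_pos: "\<bar>x\<bar> < 1 \<Longrightarrow> legendre_form x n > 0"
proof (induction n)
  case 0
  then show ?case using abs_square_less_1[of x] by (simp add: legendre_form_def power2_eq_square)
next
  case (Suc n)
  have "1 - x\<^sup>2 \<ge> 0" using Suc.prems abs_square_less_1[of x] by simp
  moreover have "1 - mesh n \<noteq> 0" using mesh_le[of n] by simp
  ultimately show ?case
    unfolding legendre_form_Suc using Suc mesh_nonneg[of n] mesh_le[of n]
    by (intro add_pos_nonneg mult_pos_pos mult_nonneg_nonneg) auto
qed

text \<open>
A correction of \<open>(n + 1) Q\<^sub>n\<close>, chosen so that its increments are of order \<open>Q\<^sub>n / n\<close>. Those of \<open>(n + 1) Q\<^sub>n\<close> itself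
are of order \<open>Q\<^sub>n\<close>, which would not be summable after division by \<open>(n + 1) Q\<^sub>n\<close>.
\<close>
definition amplitude :: "real \<Rightarrow> nat \<Rightarrow> real" where
  "amplitude x n = (real n + 1) * legendre_form x n
     + x * legendre_prod x x 1 n - legendre_prod x x 3 n"

lemma amplitude_Suc:
  "amplitude x (Suc n) - amplitude x n = mesh n * (legendre_prod x x 3 n - x * legendre_prod x x 1 n)"
proof -
  define p q where "p = legendre (Suc n) x" and "q = legendre n x"
  have form: "legendre_form x n = p ^ 2 - 2 * x * p * q + q ^ 2"
    by (simp add: legendre_form_def p_def q_def)
  have S: "real (Suc n) + 1 = real n + 2" by simp
  have "(real n + 2) * legendre_form x (Suc n) =
      ((real n + 2) * (1 - mesh n)) * (1 - mesh n) * legendre_form x n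
      + (1 - x\<^sup>2) * ((real n + 2) * mesh n) * (2 - mesh n) * p ^ 2"
    unfolding legendre_form_Suc p_def by algebra
  also have "(real n + 2) * (1 - mesh n) = real n + 1"
    using mesh_mult[of n] by (simp add: algebra_simps)
  finally have "(real n + 2) * legendre_form x (Suc n) =
      (real n + 1 - (real n + 1) * mesh n) * legendre_form x n + (1 - x\<^sup>2) * (2 - mesh n) * p ^ 2"
    unfolding mesh_mult by (simp add: algebra_simps)
  moreover have "(real n + 1) * mesh n = 1 - mesh n"
    using mesh_mult[of n] by (simp add: algebra_simps)
  ultimately have Q: "(real n + 2) * legendre_form x (Suc n) =
      (real n + 1 - (1 - mesh n)) * legendre_form x n + (1 - x\<^sup>2) * (2 - mesh n) * p ^ 2"
    by simp
  show ?thesis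
    unfolding amplitude_def S Q form legendre_prod_simps legendre_Suc_Suc
      p_def[symmetric] q_def[symmetric]
    by algebra
qed

text \<open>
The relative increments of the amplitude are \<open>O(n\<^sup>-\<^sup>2)\<close>, so it stays between positive constants, and the amplitude is
comparable to \<open>(n + 1) Q\<^sub>n\<close> for large \<open>n\<close>.
\<close>
lemma legendre_form_asymptotics:
  assumes x: "\<bar>x\<bar> < 1"
  obtains c C n0 where "c > 0" "\<And>n. n \<ge> n0 \<Longrightarrow> c * mesh n \<le> legendre_form x n"
    "\<And>n. legendre_form x n \<le> C * mesh n"
proof -
  define \<kappa> where "\<kappa> = 2 / (1 - x\<^sup>2)"
  have c0: "1 - x\<^sup>2 > 0" using x abs_square_less_1[of x] by simp
  then have \<kappa>: "\<kappa> > 0" by (simp add: \<kappa>_def)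
  define T where "T n = (real n + 1) * legendre_form x n" for n
  have T: "T n > 0" for n using legendre_form_pos[OF x, of n] by (simp add: T_def)
  have dev: "\<bar>legendre_prod x x 3 n - x * legendre_prod x x 1 n\<bar> \<le> \<kappa> * legendre_form x n" for n
  proof -
    let ?p = "legendre (Suc n) x" and ?q = "legendre n x" and ?Q = "legendre_form x n"
    have p: "?p ^ 2 \<le> ?Q / (1 - x\<^sup>2)" and q: "?q ^ 2 \<le> ?Q / (1 - x\<^sup>2)"
      using legendre_form_ge[of x n] c0 by (simp_all add: field_simps)
    have "\<bar>x * (?p * ?q)\<bar> \<le> 1 * \<bar>?p * ?q\<bar>"
      unfolding abs_mult[of x] using x by (intro mult_right_mono) auto
    also have "\<bar>?p * ?q\<bar> \<le> (?p ^ 2 + ?q ^ 2) / 2"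
      using zero_le_power2[of "\<bar>?p\<bar> - \<bar>?q\<bar>"] by (simp add: abs_mult power2_diff)
    finally have "\<bar>x * (?p * ?q)\<bar> \<le> ?Q / (1 - x\<^sup>2)" using p q by simp
    moreover have "\<kappa> * ?Q = ?Q / (1 - x\<^sup>2) + ?Q / (1 - x\<^sup>2)" by (simp add: \<kappa>_def)
    ultimately show ?thesis
      using q zero_le_power2[of ?q] unfolding legendre_prod_simps power2_eq_square by linarith
  qed
  obtain n0 where n0: "4 * \<kappa> \<le> real n0" using real_arch_simple by blast
  \<comment> \<open>The sequences \<open>l\<close> and \<open>u\<close> take values in \<open>[1, 2]\<close> from \<open>n0\<close> on and move by \<open>2 \<delta>\<close> in each step, the first down and
    the second up. They therefore change faster than the amplitude can, whose relative change is at most \<open>\<delta>\<close>.\<close>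
  define \<delta> where "\<delta> n = 2 * \<kappa> / ((real n + 1) * (real n + 2))" for n
  define l where "l n = 1 + 4 * \<kappa> / (real n + 1)" for n
  define u where "u n = 2 - 4 * \<kappa> / (real n + 1)" for n
  have frac: "0 \<le> 4 * \<kappa> / (real n + 1)" "4 * \<kappa> / (real n + 1) \<le> 1" if "n \<ge> n0" for n
    using n0 \<kappa> that by (auto simp: field_simps)
  have close: "\<bar>amplitude x n - T n\<bar> \<le> T n / 4" if "n \<ge> n0" for n
  proof -
    have "\<bar>amplitude x n - T n\<bar> \<le> \<kappa> * legendre_form x n"
      using dev[of n] by (simp add: amplitude_def T_def abs_minus_commute)
    also have "\<dots> = T n / 4 * (4 * \<kappa> / (real n + 1))" by (simp add: T_def)
    also have "\<dots> \<le> T n / 4 * 1" using frac[OF that] T[of n] by (intro mult_left_mono) auto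
    finally show ?thesis by simp
  qed
  have step: "\<bar>amplitude x (Suc n) - amplitude x n\<bar> \<le> \<delta> n * amplitude x n" if "n \<ge> n0" for n
  proof -
    have "\<bar>amplitude x (Suc n) - amplitude x n\<bar> \<le> mesh n * (\<kappa> * legendre_form x n)"
      unfolding amplitude_Suc abs_mult using dev[of n] mesh_nonneg[of n] by (simp add: mult_left_mono)
    also have "\<dots> = \<delta> n / 2 * T n"
    proof -
      have "1 / b * (\<kappa> * q) = 2 * \<kappa> / (a * b) / 2 * (a * q)" if "a \<noteq> 0" for a b q :: real
        using that by simp
      from this[of "real n + 1"] show ?thesis by (simp add: \<delta>_def T_def mesh_def)
    qed
    also have "\<dots> \<le> \<delta> n / 2 * (2 * amplitude x n)"
    proof (rule mult_left_mono)
      show "T n \<le> 2 * amplitude x n" using close[OF that] T[of n] by linarith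
    qed (use \<kappa> in \<open>simp add: \<delta>_def\<close>)
    finally show ?thesis by simp
  qed
  have \<delta>: "\<delta> n \<ge> 0" "2 * \<delta> n = l n - l (Suc n)" "2 * \<delta> n = u (Suc n) - u n" for n
    using \<kappa> by (simp_all add: \<delta>_def l_def u_def field_simps)
  have lu: "1 \<le> l n" "l n \<le> 2" "1 \<le> u n" "u n \<le> 2" if "n \<ge> n0" for n
    using frac[OF that] by (simp_all add: l_def u_def)
  have E: "amplitude x n > 0" if "n \<ge> n0" for n
    using close[OF that] T[of n] by linarith
  have lower: "amplitude x n0 * l n \<le> amplitude x n * l n0" if "n \<ge> n0" for n
    using that
  proof (induction n rule: dec_induct)
    case (step n)
    have n: "n \<ge> n0" by fact
    have "\<delta> n * l n \<le> \<delta> n * 2" using \<delta>(1)[of n] lu(2)[OF n] by (rule mult_left_mono[rotated])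
    then have A: "l (Suc n) \<le> (1 - \<delta> n) * l n" using \<delta>(2)[of n] by (simp add: algebra_simps)
    have B: "(1 - \<delta> n) * amplitude x n \<le> amplitude x (Suc n)"
      using \<open>n \<ge> n0\<close> \<open>\<And>n. n0 \<le> n \<Longrightarrow> \<bar>amplitude x (Suc n) - amplitude x n\<bar> \<le> \<delta> n * amplitude x n\<close>[of n]
      by (simp add: algebra_simps abs_le_iff)
    have "1 - \<delta> n \<ge> 0"
    proof -
      have "0 \<le> (1 - \<delta> n) * l n" using A lu(1)[of "Suc n"] n by simp
      then show ?thesis using lu(1)[OF n] by (simp add: zero_le_mult_iff)
    qed
    have "amplitude x n0 * l (Suc n) \<le> amplitude x n0 * ((1 - \<delta> n) * l n)"
      using A E[of n0] by (intro mult_left_mono) auto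
    also have "\<dots> = (1 - \<delta> n) * (amplitude x n0 * l n)" by simp
    also have "\<dots> \<le> (1 - \<delta> n) * (amplitude x n * l n0)"
      using step.IH \<open>1 - \<delta> n \<ge> 0\<close> by (rule mult_left_mono)
    also have "\<dots> = ((1 - \<delta> n) * amplitude x n) * l n0" by simp
    also have "\<dots> \<le> amplitude x (Suc n) * l n0"
      using B lu(1)[of n0] by (intro mult_right_mono) auto
    finally show ?case .
  qed simp
  have upper: "amplitude x n * u n0 \<le> amplitude x n0 * u n" if "n \<ge> n0" for n
    using that
  proof (induction n rule: dec_induct)
    case (step n)
    have n: "n \<ge> n0" by fact
    have "\<delta> n * u n \<le> \<delta> n * 2" using \<delta>(1)[of n] lu(4)[OF n] by (rule mult_left_mono[rotated])
    then have A: "(1 + \<delta> n) * u n \<le> u (Suc n)" using \<delta>(3)[of n] by (simp add: algebra_simps)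
    have B: "amplitude x (Suc n) \<le> (1 + \<delta> n) * amplitude x n"
      using \<open>n \<ge> n0\<close> \<open>\<And>n. n0 \<le> n \<Longrightarrow> \<bar>amplitude x (Suc n) - amplitude x n\<bar> \<le> \<delta> n * amplitude x n\<close>[of n]
      by (simp add: algebra_simps abs_le_iff)
    have "amplitude x (Suc n) * u n0 \<le> ((1 + \<delta> n) * amplitude x n) * u n0"
      using B lu(3)[of n0] by (intro mult_right_mono) auto
    also have "\<dots> = (1 + \<delta> n) * (amplitude x n * u n0)" by simp
    also have "\<dots> \<le> (1 + \<delta> n) * (amplitude x n0 * u n)"
      using step.IH \<delta>(1)[of n] by (intro mult_left_mono) auto
    also have "\<dots> = amplitude x n0 * ((1 + \<delta> n) * u n)" by simp
    also have "\<dots> \<le> amplitude x n0 * u (Suc n)"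
      using A E[of n0] by (intro mult_left_mono) auto
    finally show ?case .
  qed simp
  define a where "a = amplitude x n0"
  have a: "a > 0" using E[of n0] by (simp add: a_def)
  have bounds: "a / 4 \<le> T n" "T n \<le> 4 * a" if n: "n \<ge> n0" for n
  proof -
    have "a * 1 \<le> a * l n" using a lu(1)[OF n] by (intro mult_left_mono) auto
    also have "\<dots> \<le> amplitude x n * l n0" using lower[OF n] by (simp add: a_def)
    also have "\<dots> \<le> amplitude x n * 2" using E[OF n] lu(2)[of n0] by (intro mult_left_mono) auto
    finally show "a / 4 \<le> T n" using close[OF n] T[of n] by linarith
    have "amplitude x n * 1 \<le> amplitude x n * u n0" using E[OF n] lu(3)[of n0] by (intro mult_left_mono) auto
    also have "\<dots> \<le> a * u n" using upper[OF n] by (simp add: a_def)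
    also have "\<dots> \<le> a * 2" using a lu(4)[OF n] by (intro mult_left_mono) auto
    finally show "T n \<le> 4 * a" using close[OF n] T[of n] by linarith
  qed
  have Q: "legendre_form x n = (T n / (real n + 1) * (real n + 2)) * mesh n" for n
    using mesh_mult[of n] by (simp add: T_def mult.assoc)
  show ?thesis
  proof (rule that[of "a / 4" n0 "max (8 * a) (real n0 + 2)"])
    show "a / 4 > 0" using a by simp
    show "a / 4 * mesh n \<le> legendre_form x n" if n: "n \<ge> n0" for n
    proof -
      have "a / 4 * 1 \<le> T n * ((real n + 2) / (real n + 1))"
        using bounds(1)[OF n] T[of n] by (intro mult_mono) (auto simp: field_simps)
      then show ?thesis
        unfolding Q using mesh_nonneg[of n] by (intro mult_right_mono) auto
    qed
    show "legendre_form x n \<le> max (8 * a) (real n0 + 2) * mesh n" for n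
    proof (cases "n \<ge> n0")
      case True
      have "T n * ((real n + 2) / (real n + 1)) \<le> (4 * a) * 2"
        using bounds(2)[OF True] T[of n] a by (intro mult_mono) (auto simp: field_simps)
      then show ?thesis
        unfolding Q using mesh_nonneg[of n] by (intro mult_right_mono) auto
    next
      case False
      have "legendre_form x n \<le> 1"
        using legendre_form_le[of x n] zero_le_power2[of x] by linarith
      also have "1 = (real n + 2) * mesh n" by (simp add: mesh_mult)
      also have "\<dots> \<le> max (8 * a) (real n0 + 2) * mesh n"
        using False mesh_nonneg[of n] by (intro mult_right_mono) auto
      finally show ?thesis .
    qed
  qed
qed

lemma K2_term_diagonal:
  "K2_term t x x (Suc n) = of_real ((real n + 3 / 2) * legendre (Suc n) x ^ 2) * exp (- t * harm (Suc n))"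
  by (simp add: K2_term_def legendre_def power2_eq_square field_simps)

text \<open>
Coefficients of size \<open>n\<^sup>e\<^sup>-\<^sup>1\<close> give convergence for \<open>Re t > e\<close>. In the interior this improves the half plane
\<open>Re t > 2\<close> to \<open>Re t > 1\<close>, up to the pole.
\<close>
lemma harm_series_holomorphic:
  fixes a :: "nat \<Rightarrow> real"
  assumes a: "\<And>n. \<bar>a n\<bar> \<le> C * mesh n powr (1 - e)" and e: "e \<ge> 0"
  shows "\<And>t. Re t > e \<Longrightarrow> summable (\<lambda>n. of_real (a n) * exp (- t * harm (Suc n)))"
    and "(\<lambda>t. \<Sum>n. of_real (a n) * exp (- t * harm (Suc n))) holomorphic_on {t. Re t > e}"
proof -
  let ?f = "\<lambda>n t. complex_of_real (a n) * exp (- t * harm (Suc n))"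
  have M: "\<exists>r>0. \<exists>M. summable M \<and> (\<forall>n. \<forall>y\<in>ball x r \<inter> {t. Re t > e}. norm (?f n y) \<le> M n)"
    if x: "x \<in> {t. Re t > e}" for x
  proof -
    define r where "r = (Re x - e) / 2"
    have r: "r > 0" using x by (simp add: r_def)
    have "norm (?f n y) \<le> C * mesh n powr (1 + r)" if y: "y \<in> ball x r \<inter> {t. Re t > e}" for n y
    proof -
      have "\<bar>Re (x - y)\<bar> \<le> norm (x - y)" by (rule abs_Re_le_cmod)
      also have "\<dots> < r" using y by (simp add: dist_norm)
      finally have "Re x - Re y < r" using abs_ge_self[of "Re (x - y)"] by simp
      moreover have "Re x = e + 2 * r" by (simp add: r_def field_simps)
      ultimately have Re: "Re y \<ge> e + r" by linarith
      have "norm (exp (- y * harm (Suc n))) \<le> mesh n powr Re y"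
        using y e by (intro norm_exp_harm_decay) auto
      also have "\<dots> \<le> mesh n powr (e + r)"
        using Re mesh_pos[of n] mesh_le[of n] by (intro powr_mono') auto
      finally have "\<bar>a n\<bar> * norm (exp (- y * harm (Suc n))) \<le> C * mesh n powr (1 - e) * mesh n powr (e + r)"
        using a[of n] by (intro mult_mono) auto
      also have "\<dots> = C * mesh n powr (1 + r)"
        by (simp add: powr_add[symmetric])
      finally show ?thesis by (simp add: norm_mult)
    qed
    moreover have "summable (\<lambda>n. C * mesh n powr (1 + r))"
      using r by (intro summable_mult summable_mesh_powr) simp
    ultimately show ?thesis using r by blast
  qed
  have hol: "?f n holomorphic_on {t. Re t > e}" for n by (intro holomorphic_intros)
  from holomorphic_suminf[OF open_halfspace_Re_gt hol M]
  show "\<And>t. Re t > e \<Longrightarrow> summable (\<lambda>n. ?f n t)"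
    and "(\<lambda>t. \<Sum>n. ?f n t) holomorphic_on {t. Re t > e}" by auto
qed

text \<open>
If the sum extended continuously to \<open>\<sigma>\<close>, its value there would bound every partial sum at \<open>\<sigma>\<close>, by letting
\<open>t\<close> decrease to \<open>\<sigma>\<close> in the partial sums of nonnegative terms.
\<close>
lemma not_analytic_of_divergence:
  fixes a :: "nat \<Rightarrow> real" and \<sigma> :: real
  assumes a: "\<And>n. a n \<ge> 0"
    and sums: "\<And>t. t > \<sigma> \<Longrightarrow> (\<lambda>n. of_real (a n) * exp (- of_real t * harm (Suc n))) sums (K (of_real t) - 1 / 2)"
    and div: "\<not> summable (\<lambda>n. a n * exp (- \<sigma> * harm (Suc n)))"
  shows "\<not> K analytic_on {of_real \<sigma>}"
proof
  assume "K analytic_on {of_real \<sigma>}"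
  then have cont: "K \<midarrow>of_real \<sigma>\<rightarrow> K (of_real \<sigma>)"
    by (intro isContD analytic_at_imp_isCont)
  have "filterlim (\<lambda>t. complex_of_real t) (at (of_real \<sigma>)) (at_right \<sigma>)"
    by (rule filterlim_atI) (auto intro!: tendsto_intros simp: eventually_at_filter)
  from filterlim_compose[OF cont this]
  have lim: "((\<lambda>t. Re (K (of_real t) - 1 / 2)) \<longlongrightarrow> Re (K (of_real \<sigma>) - 1 / 2)) (at_right \<sigma>)"
    by (intro tendsto_intros)
  have partial: "(\<Sum>n<M. a n * exp (- \<sigma> * harm (Suc n))) \<le> Re (K (of_real \<sigma>) - 1 / 2)" for M
  proof (rule tendsto_le[OF _ lim])
    show "((\<lambda>t. \<Sum>n<M. a n * exp (- t * harm (Suc n))) \<longlongrightarrow> (\<Sum>n<M. a n * exp (- \<sigma> * harm (Suc n)))) (at_right \<sigma>)"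
      by (intro tendsto_intros)
    have "(\<Sum>n<M. a n * exp (- t * harm (Suc n))) \<le> Re (K (of_real t) - 1 / 2)" if t: "t > \<sigma>" for t
    proof -
      have "complex_of_real (a n) * exp (- of_real t * harm (Suc n)) = of_real (a n * exp (- t * harm (Suc n)))" for n
        by (simp add: of_real_harm exp_of_real[symmetric])
      from sums_Re[OF sums[OF t], unfolded this Re_complex_of_real]
      have s: "(\<lambda>n. a n * exp (- t * harm (Suc n))) sums Re (K (of_real t) - 1 / 2)" .
      have "(\<Sum>n<M. a n * exp (- t * harm (Suc n))) \<le> (\<Sum>n. a n * exp (- t * harm (Suc n)))"
        by (rule sum_le_suminf[OF sums_summable[OF s]]) (auto simp: a)
      then show ?thesis using sums_unique[OF s] by simp
    qed
    then show "\<forall>\<^sub>F t in at_right \<sigma>. (\<Sum>n<M. a n * exp (- t * harm (Suc n))) \<le> Re (K (of_real t) - 1 / 2)"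
      by (auto simp: eventually_at_filter)
  qed simp
  have "summable (\<lambda>n. a n * exp (- \<sigma> * harm (Suc n)))"
    by (rule summableI_nonneg_bounded[OF _ partial]) (simp add: a)
  with div show False ..
qed

lemma not_summable_mesh: "\<not> summable mesh"
proof
  assume "summable mesh"
  then have "summable (\<lambda>n. inverse (real (n + 2)))"
    by (simp add: mesh_def[abs_def] inverse_eq_divide add_ac)
  then have "summable (\<lambda>n. inverse (real n))"
    by (subst (asm) summable_iff_shift)
  then show False using not_summable_harmonic[where 'a = real] by simp
qed

lemma exp_neg_harm_ge: "exp (- harm (Suc n)) \<ge> exp (- 1) * (mesh n :: real)"
proof -
  have "harm (Suc n) \<le> 1 + ln (real n + 2)"
  proof -
    have "ln (real (Suc n)) \<le> ln (real n + 2)" by simp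
    then show ?thesis using harm_le_ln[of n] by linarith
  qed
  then have "exp (- (1 + ln (real n + 2))) \<le> exp (- harm (Suc n) :: real)" by simp
  also have "exp (- (1 + ln (real n + 2))) = exp (- 1) * mesh n"
    by (simp add: exp_diff exp_minus mesh_def field_simps)
  finally show ?thesis .
qed

text \<open>
At the end points the coefficients are \<open>n + 3/2\<close> and the weights at \<open>t = 2\<close> are at least a multiple of \<open>n\<^sup>-\<^sup>2\<close>. In the
interior the weights at \<open>t = 1\<close> reduce divergence to that of the series of \<open>P\<^sub>n\<^sup>2\<close>; two consecutive squares dominate
the form, which is at least a multiple of \<open>1 / n\<close>.
\<close>
lemma diagonal_growth:
  fixes x :: real
  defines "a \<equiv> \<lambda>n. (real n + 3 / 2) * legendre (Suc n) x ^ 2"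
  assumes x: "\<bar>x\<bar> \<le> 1"
  obtains C where "\<And>n. \<bar>a n\<bar> \<le> C * mesh n powr (1 - real (1 + endpoint_delta x))"
    "\<not> summable (\<lambda>n. a n * exp (- real (1 + endpoint_delta x) * harm (Suc n)))"
proof (cases "\<bar>x\<bar> = 1")
  case True
  then have x: "x = 1 \<or> x = -1" by linarith
  then have \<delta>: "endpoint_delta x = 1" by (auto simp: endpoint_delta_def)
  have a: "a n = real n + 3 / 2" for n
    using x by (auto simp: a_def legendre_endpoint power_mult[symmetric] power_even_eq)
  show ?thesis
  proof (rule that[of 1])
    have "mesh n powr - 1 = real n + 2" for n
      using mesh_pos[of n] by (simp add: powr_minus mesh_def)
    then show "\<bar>a n\<bar> \<le> 1 * mesh n powr (1 - real (1 + endpoint_delta x))" for n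
      by (simp add: \<delta> a)
    have "mesh n * exp (- 1) ^ 2 / 2 \<le> a n * exp (- 2 * harm (Suc n))" for n
    proof -
      have "1 \<le> 2 * a n * mesh n" by (simp add: a mesh_def field_simps)
      then have "mesh n * exp (- 1) ^ 2 / 2 * 1 \<le> mesh n * exp (- 1) ^ 2 / 2 * (2 * a n * mesh n)"
        using mesh_nonneg[of n] by (intro mult_left_mono) auto
      also have "\<dots> = a n * (exp (- 1) * mesh n) ^ 2" by (simp add: power2_eq_square)
      also have "\<dots> \<le> a n * exp (- harm (Suc n)) ^ 2"
        using exp_neg_harm_ge[of n] mesh_nonneg[of n] by (intro mult_left_mono power_mono) (auto simp: a)
      also have "exp (- harm (Suc n)) ^ 2 = (exp (- 2 * harm (Suc n)) :: real)"
        by (simp add: power2_eq_square exp_add[symmetric])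
      finally show ?thesis by simp
    qed
    then have "norm (exp (- 1) ^ 2 / 2 * mesh n) \<le> a n * exp (- 2 * harm (Suc n))" for n
      using mesh_nonneg[of n] by (simp add: abs_mult mult.commute)
    then have "summable (\<lambda>n. a n * exp (- 2 * harm (Suc n))) \<Longrightarrow> summable (\<lambda>n. exp (- 1) ^ 2 / 2 * mesh n)"
      by (rule summable_comparison_test'[rotated])
    then show "\<not> summable (\<lambda>n. a n * exp (- real (1 + endpoint_delta x) * harm (Suc n)))"
      using not_summable_mesh by (auto simp: \<delta> summable_cmult_iff)
  qed
next
  case False
  with x have x: "\<bar>x\<bar> < 1" by simp
  then have \<delta>: "endpoint_delta x = 0" by (auto simp: endpoint_delta_def)
  have c0: "1 - x\<^sup>2 > 0" using x abs_square_less_1[of x] by simp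
  obtain c C n0 where asy: "c > 0" "\<And>n. n \<ge> n0 \<Longrightarrow> c * mesh n \<le> legendre_form x n"
    "\<And>n. legendre_form x n \<le> C * mesh n"
    using legendre_form_asymptotics[OF x] by metis
  show ?thesis
  proof (rule that[of "C / (1 - x\<^sup>2)"])
    fix n
    have "\<bar>a n\<bar> \<le> (real n + 2) * legendre (Suc n) x ^ 2"
      by (auto simp: a_def abs_mult intro!: mult_right_mono)
    also have "\<dots> \<le> (real n + 2) * (C * mesh n / (1 - x\<^sup>2))"
      using order_trans[OF legendre_form_ge(1)[of x n] asy(3)[of n]] c0
      by (intro mult_left_mono) (auto simp: field_simps)
    also have "\<dots> = C / (1 - x\<^sup>2) * ((real n + 2) * mesh n)" by simp
    finally show "\<bar>a n\<bar> \<le> C / (1 - x\<^sup>2) * mesh n powr (1 - real (1 + endpoint_delta x))"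
      using mesh_pos[of n] by (simp add: \<delta> mesh_mult)
  next
    show "\<not> summable (\<lambda>n. a n * exp (- real (1 + endpoint_delta x) * harm (Suc n)))"
    proof
      assume "summable (\<lambda>n. a n * exp (- real (1 + endpoint_delta x) * harm (Suc n)))"
      then have s: "summable (\<lambda>n. a n * exp (- harm (Suc n)))" by (simp add: \<delta>)
      have "exp (- 1) / 2 * legendre (Suc n) x ^ 2 \<le> a n * exp (- harm (Suc n))" for n
      proof -
        have "1 / 2 \<le> (real n + 3 / 2) * mesh n" by (simp add: mesh_def field_simps)
        then have "legendre (Suc n) x ^ 2 * exp (- 1) * (1 / 2) \<le> legendre (Suc n) x ^ 2 * exp (- 1) * ((real n + 3 / 2) * mesh n)"
          by (intro mult_left_mono) auto
        also have "\<dots> = a n * (exp (- 1) * mesh n)" by (simp add: a_def)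
        also have "\<dots> \<le> a n * exp (- harm (Suc n))"
          using exp_neg_harm_ge[of n] by (intro mult_left_mono) (auto simp: a_def)
        finally show ?thesis by (simp add: mult.commute)
      qed
      then have "summable (\<lambda>n. exp (- 1) / 2 * legendre (Suc n) x ^ 2)"
        by (intro summable_comparison_test'[OF s]) auto
      then have s1: "summable (\<lambda>n. legendre (Suc n) x ^ 2)" by (simp add: summable_cmult_iff)
      then have "summable (\<lambda>n. legendre n x ^ 2)" by (subst (asm) summable_Suc_iff)
      then have "summable (\<lambda>n. 2 * (legendre (Suc n) x ^ 2 + legendre n x ^ 2))"
        using s1 by (intro summable_mult summable_add)
      then have "summable (\<lambda>n. c * mesh n)"
      proof (rule summable_comparison_test')
        fix n assume n: "n \<ge> n0"
        have "\<bar>x * (legendre (Suc n) x * legendre n x)\<bar> \<le> 1 * \<bar>legendre (Suc n) x * legendre n x\<bar>"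
          unfolding abs_mult[of x] using x by (intro mult_right_mono) auto
        also have "\<dots> \<le> (legendre (Suc n) x ^ 2 + legendre n x ^ 2) / 2"
          using zero_le_power2[of "\<bar>legendre (Suc n) x\<bar> - \<bar>legendre n x\<bar>"] by (simp add: abs_mult power2_diff)
        finally have "legendre_form x n \<le> 2 * (legendre (Suc n) x ^ 2 + legendre n x ^ 2)"
          unfolding legendre_form_def by (simp add: mult.assoc)
        then show "norm (c * mesh n) \<le> 2 * (legendre (Suc n) x ^ 2 + legendre n x ^ 2)"
          using asy(2)[OF n] asy(1) mesh_nonneg[of n] by (simp add: abs_mult)
      qed
      then show False using asy(1) not_summable_mesh by (simp add: summable_cmult_iff)
    qed
  qed
qed


section \<open>Gluing the continuations\<close>
lemma has_simple_pole_cong: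
  assumes "eventually (\<lambda>w. f w = g w) (at z)"
  shows "has_simple_pole f z \<longleftrightarrow> has_simple_pole g z"
  unfolding has_simple_pole_def
  using isolated_singularity_at_cong[OF assms refl] is_pole_cong[OF assms refl] zorder_cong[OF assms refl]
  by simp

lemma simple_pole_or_removable:
  assumes U: "open U" "s \<in> U" and h: "h holomorphic_on U"
    and f: "\<And>w. w \<in> U - {s} \<Longrightarrow> f w = h w / (w - s)"
  shows "has_simple_pole (remove_sings f) s \<or> remove_sings f analytic_on {s}"
proof -
  have "f holomorphic_on U - {s}"
    using holomorphic_on_subset[OF h]
    by (subst holomorphic_cong[OF refl f]) (auto intro!: holomorphic_intros)
  then have "f analytic_on U - {s}"
    using U(1) by (simp add: analytic_on_open open_delete)
  then have iso: "isolated_singularity_at f s"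
    unfolding isolated_singularity_at_def
    using open_contains_ball[of U] U by (meson Diff_mono analytic_on_subset order_refl)
  have U_at: "eventually (\<lambda>w. w \<in> U - {s}) (at s)"
    using U by (auto simp: eventually_at_filter eventually_nhds)
  show ?thesis
  proof (cases "h s = 0")
    case True
    have "(h has_field_derivative deriv h s) (at s)"
      using holomorphic_derivI[OF h U] .
    then have "((\<lambda>w. (h w - h s) / (w - s)) \<longlongrightarrow> deriv h s) (at s)"
      by (simp add: has_field_derivative_iff)
    then have "f \<midarrow>s\<rightarrow> deriv h s"
      by (rule Lim_transform_eventually) (use U_at True f in \<open>auto elim!: eventually_mono\<close>)
    from remove_sings_analytic_at[OF iso this] show ?thesis ..
  next
    case False
    have "isCont h s"
      using h U continuous_on_eq_continuous_at holomorphic_on_imp_continuous_on by blast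
    moreover have "filterlim (\<lambda>w. w - s) (at 0) (at s)"
      by (rule filterlim_atI) (auto intro!: tendsto_eq_intros simp: eventually_at_filter)
    ultimately have "filterlim (\<lambda>w. h w / (w - s)) at_infinity (at s)"
      using False by (intro filterlim_divide_at_infinity[of h "h s"]) (auto simp: isCont_def)
    then have pole: "is_pole f s"
      unfolding is_pole_def
      by (rule filterlim_mono_eventually) (use U_at f in \<open>auto elim!: eventually_mono\<close>)
    have "zorder f s = - 1"
      by (rule zorder_eqI[OF U h False]) (use f in \<open>auto simp: power_int_minus divide_inverse\<close>)
    with iso pole have "has_simple_pole f s" by (simp add: has_simple_pole_def)
    then show ?thesis
      using has_simple_pole_cong[OF eventually_remove_sings_eq_at[OF iso]] by simp
  qed
qed

text \<open>
Quotients of the holomorphic continuations by the products of linear factors agree on common half planes by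
the identity theorem. At a zero of its denominator the quotient \<open>K0\<close> has the default value \<open>0\<close>, even
if the singularity is removable; passing to \<^const>\<open>remove_sings\<close> gives these their correct values.
\<close>
lemma glue_continuations:
  fixes f :: "complex \<Rightarrow> complex" and P :: "nat \<Rightarrow> complex set"
  assumes fin: "\<And>N. finite (P N)" and mono: "\<And>M N. M \<le> N \<Longrightarrow> P M \<subseteq> P N"
    and Re: "\<And>N s. s \<in> P N \<Longrightarrow> Re s \<le> 2"
    and cont: "\<And>N. \<exists>g. g holomorphic_on {t. Re t > - real N} \<and>
        (\<forall>t. Re t > 2 \<longrightarrow> (\<Prod>s\<in>P N. t - s) * f t = g t)"
  obtains K where "\<And>t. Re t > 2 \<Longrightarrow> K t = f t"
    "\<And>t. has_simple_pole K t \<or> K analytic_on {t}"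
    "K analytic_on UNIV - (\<Union>N. P N)"
proof -
  obtain g where g: "\<And>N. g N holomorphic_on {t. Re t > - real N}"
      "\<And>N t. Re t > 2 \<Longrightarrow> (\<Prod>s\<in>P N. t - s) * f t = g N t"
    using cont by metis
  define p where "p N t = (\<Prod>s\<in>P N. t - s)" for N t
  have p_hol: "p N holomorphic_on A" for N A
    unfolding p_def[abs_def] by (intro holomorphic_intros)
  have p0: "p N t = 0 \<longleftrightarrow> t \<in> P N" for N t
    using fin by (simp add: p_def)
  have consistent: "g M t * p N t = g N t * p M t" if "M \<le> N" "Re t > - real M" for M N t
  proof (rule analytic_continuation_open[where s = "{t. Re t > 2}" and s' = "{t. Re t > - real M}"
        and f = "\<lambda>t. g M t * p N t" and g = "\<lambda>t. g N t * p M t"])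
    show "{t. Re t > 2} \<noteq> {}" by (auto intro!: exI[of _ 3])
    show "connected {t. Re t > - real M}"
      by (intro convex_connected convex_halfspace_Re_gt)
    show "g M z * p N z = g N z * p M z" if "z \<in> {t. Re t > 2}" for z
    proof -
      have "g M z = p M z * f z" "g N z = p N z * f z"
        using g(2)[of z] that by (simp_all add: p_def)
      then show ?thesis by simp
    qed
    have "{t. Re t > - real M} \<subseteq> {t. Re t > - real N}" using \<open>M \<le> N\<close> by auto
    then show "(\<lambda>t. g N t * p M t) holomorphic_on {t. Re t > - real M}"
      by (intro holomorphic_intros p_hol holomorphic_on_subset[OF g(1)])
  qed (use that in \<open>auto intro!: holomorphic_intros p_hol g open_halfspace_Re_gt\<close>)
  define L where "L t = (LEAST N. Re t > - real N)" for t
  have L: "Re t > - real (L t)" "Re t > - real N \<Longrightarrow> L t \<le> N" for t N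
  proof -
    have "\<exists>N. Re t > - real N"
      using reals_Archimedean2[of "- Re t"] by (metis minus_less_iff)
    then show "Re t > - real (L t)" unfolding L_def by (rule LeastI_ex)
    show "Re t > - real N \<Longrightarrow> L t \<le> N" unfolding L_def by (rule Least_le)
  qed
  define K0 where "K0 t = g (L t) t / p (L t) t" for t
  have K0: "K0 t = g N t / p N t" if "Re t > - real N" "t \<notin> P N" for N t
  proof -
    have "t \<notin> P (L t)" using mono[OF L(2)[OF that(1)]] that(2) by blast
    then show ?thesis
      using consistent[OF L(2)[OF that(1)] L(1)] that(2) p0 by (simp add: K0_def divide_simps)
  qed
  have opn: "open ({t. Re t > - real N} - A)" if "finite A" for N and A :: "complex set"
    by (intro open_Diff finite_imp_closed that open_halfspace_Re_gt)
  have K0_an: "K0 analytic_on {t}" if "Re t > - real N" "t \<notin> P N" for N t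
  proof -
    let ?U = "{t. Re t > - real N} - P N"
    have "(\<lambda>t. g N t / p N t) holomorphic_on ?U"
      using p0 by (intro holomorphic_intros p_hol holomorphic_on_subset[OF g(1)]) auto
    then have "K0 holomorphic_on ?U"
      by (rule holomorphic_transform) (use K0 in auto)
    then show ?thesis
      using that opn[OF fin] by (auto simp: analytic_at)
  qed
  define K where "K = remove_sings K0"
  have an: "K analytic_on {t}" "K t = K0 t" if "Re t > - real N" "t \<notin> P N" for N t
    using K0_an[OF that] by (simp_all add: K_def remove_sings_analytic_on)
  show ?thesis
  proof
    fix t :: complex assume t: "Re t > 2"
    then have "t \<notin> P 0" using Re[of t 0] by auto
    with t have "K t = g 0 t / p 0 t" using an(2)[of 0 t] K0[of 0 t] by simp
    also have "g 0 t = p 0 t * f t" using g(2)[OF t, of 0] by (simp add: p_def)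
    finally show "K t = f t" using p0[of 0 t] \<open>t \<notin> P 0\<close> by simp
  next
    fix s
    obtain N where N: "Re s > - real N" using L(1) by blast
    show "has_simple_pole K s \<or> K analytic_on {s}"
    proof (cases "s \<in> P N")
      case True
      let ?U = "{t. Re t > - real N} - (P N - {s})" and ?q = "\<lambda>t. \<Prod>s\<in>P N - {s}. t - s"
      have q: "p N t = (t - s) * ?q t" for t
        unfolding p_def using True fin by (rule prod.remove[rotated])
      have q0: "?q t \<noteq> 0" if "t \<in> ?U" for t using that fin by auto
      show ?thesis
        unfolding K_def
      proof (rule simple_pole_or_removable[of ?U s "\<lambda>t. g N t / ?q t"])
        show "open ?U" using fin by (intro opn) auto
        show "(\<lambda>t. g N t / ?q t) holomorphic_on ?U"
          by (intro holomorphic_intros holomorphic_on_subset[OF g(1)] q0) auto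
        fix t assume t: "t \<in> ?U - {s}"
        then have "K0 t = g N t / p N t" by (intro K0) auto
        then show "K0 t = g N t / ?q t / (t - s)" by (simp add: q mult.commute)
      qed (use N in auto)
    qed (use an(1) N in auto)
  next
    have "K analytic_on {t}" if "t \<notin> (\<Union>N. P N)" for t
      using an(1)[OF L(1)] that by auto
    then show "K analytic_on UNIV - (\<Union>N. P N)"
      using analytic_on_analytic_at by blast
  qed
qed

lemma meromorphic_of_simple_poles:
  assumes "\<And>t. has_simple_pole K t \<or> K analytic_on {t}"
  shows "K meromorphic_on UNIV"
proof -
  have "K meromorphic_on {t}" for t
  proof (cases "K analytic_on {t}")
    case True
    then show ?thesis by (rule analytic_on_imp_meromorphic_on)
  next
    case False
    then have "has_simple_pole K t" using assms by blast
    then show ?thesis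
      by (auto simp: meromorphic_at_iff has_simple_pole_def not_essential_def)
  qed
  then show ?thesis by (auto simp: meromorphic_on_def)
qed


section \<open>The continued kernel\<close>
definition pole_candidates :: "real \<Rightarrow> complex set" where
  "pole_candidates x = insert (of_nat (1 + endpoint_delta x))
     {- of_nat ((1 + endpoint_delta x) * m) | m::nat. m \<ge> 1}"

lemma K2_continuation:
  assumes P: "\<And>N. finite (P N)" "\<And>M N. M \<le> N \<Longrightarrow> P M \<subseteq> P N" "\<And>N s. s \<in> P N \<Longrightarrow> Re s \<le> 2"
    and cont: "\<And>N. continues (P N) N (\<lambda>n t. K2_term t x y (Suc n))"
  obtains K where "\<And>t. Re t > 2 \<Longrightarrow> K t = K2_series t x y"
    "\<And>t. has_simple_pole K t \<or> K analytic_on {t}"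
    "K analytic_on UNIV - (\<Union>N. P N)"
proof (rule glue_continuations[OF P])
  show "\<exists>g. g holomorphic_on {t. Re t > - real N} \<and>
     (\<forall>t. Re t > 2 \<longrightarrow> (\<Prod>s\<in>P N. t - s) * K2_series t x y = g t)" for N
  proof -
    obtain g where g: "g holomorphic_on {t. Re t > - real N}"
      "\<And>t. Re t > 2 \<Longrightarrow> (\<Prod>s\<in>P N. t - s) * (\<Sum>n. K2_term t x y (Suc n)) = g t"
      using cont[of N] unfolding continues_def by blast
    show ?thesis
      by (intro exI[of _ "\<lambda>t. (\<Prod>s\<in>P N. t - s) * (1 / 2) + g t"])
         (auto intro!: holomorphic_intros g(1) simp: g(2)[symmetric] K2_series_def distrib_left)
  qed
qed (use that in blast)+

lemma K2_continuation_offdiagonal: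
  assumes "x \<in> {-1..1}" "y \<in> {-1..1}" "x \<noteq> y"
  shows "\<exists>K. (\<forall>t. Re t > 2 \<longrightarrow> summable (\<lambda>n. K2_term t x y (Suc n)) \<and> K t = K2_series t x y) \<and>
    K holomorphic_on UNIV"
proof -
  have xy: "\<bar>x\<bar> \<le> 1" "\<bar>y\<bar> \<le> 1" using assms by auto
  note cont = continues_K2_offdiagonal[OF xy assms(3)]
  obtain K where K: "\<And>t. Re t > 2 \<Longrightarrow> K t = K2_series t x y" "K analytic_on UNIV - (\<Union>N::nat. {})"
    by (rule K2_continuation[of "\<lambda>_. {}" x y, OF _ _ _ cont]) auto
  have "K holomorphic_on UNIV" using K(2) by (simp add: analytic_on_open)
  with K(1) show ?thesis
    using continues_summable[OF cont[of 0]] by blast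
qed

lemma continues_K2_diagonal:
  assumes "\<bar>x\<bar> \<le> 1"
  shows "continues (lattice_points (1 + endpoint_delta x) {0..<N + 3} - {0}) N (\<lambda>n t. K2_term t x x (Suc n))"
proof (cases "\<bar>x\<bar> = 1")
  case True
  then have "endpoint_delta x = 1" by (auto simp: endpoint_delta_def)
  then show ?thesis using continues_K2_endpoint[OF True, of N] by (simp add: numeral_2_eq_2)
next
  case False
  then have "endpoint_delta x = 0" by (auto simp: endpoint_delta_def)
  then show ?thesis using continues_K2_interior[of x N] False assms by simp
qed

lemma lattice_points_subset_candidates:
  "lattice_points (1 + endpoint_delta x) J - {0} \<subseteq> pole_candidates x"
proof
  fix s assume s: "s \<in> lattice_points (1 + endpoint_delta x) J - {0}"
  then obtain j where j: "s = of_nat (1 + endpoint_delta x) * (1 - of_nat j)"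
    by (auto simp: lattice_points_def)
  with s have "j \<noteq> 1" by auto
  then consider "j = 0" | m where "j = Suc m" "m \<ge> 1"
    by (cases j) auto
  then show "s \<in> pole_candidates x"
  proof cases
    case 1
    with j show ?thesis by (simp add: pole_candidates_def)
  next
    case 2
    then have "s = - of_nat ((1 + endpoint_delta x) * m)" by (simp add: j algebra_simps)
    with 2(2) show ?thesis unfolding pole_candidates_def by blast
  qed
qed

text \<open>
No candidate lies to the right of \<open>e\<close>, so the continuation still equals the series on \<open>Re t > e\<close>, where
\<open>not_analytic_of_divergence\<close> can be applied.
\<close>
lemma K2_diagonal_pole:
  fixes x :: real
  defines "e \<equiv> 1 + endpoint_delta x"
  assumes x: "\<bar>x\<bar> \<le> 1"
    and K: "\<And>t. Re t > 2 \<Longrightarrow> K t = K2_series t x x" "K analytic_on UNIV - pole_candidates x"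
  shows "\<not> K analytic_on {of_nat e}"
proof -
  define a where "a n = (real n + 3 / 2) * legendre (Suc n) x ^ 2" for n
  obtain C where C: "\<And>n. \<bar>a n\<bar> \<le> C * mesh n powr (1 - real e)"
    "\<not> summable (\<lambda>n. a n * exp (- real e * harm (Suc n)))"
    by (rule diagonal_growth[OF x, folded a_def e_def], rule that)
  let ?f = "\<lambda>t. \<Sum>n. of_real (a n) * exp (- t * harm (Suc n))"
  let ?U = "{t. Re t > real e}"
  have e: "1 \<le> e" "e \<le> 2" by (auto simp: e_def endpoint_delta_def)
  note series = harm_series_holomorphic[OF C(1) of_nat_0_le_iff]
  have candidates: "Re s \<le> real e" if "s \<in> pole_candidates x" for s
  proof -
    from that consider "s = of_nat e" | m where "s = - of_nat (e * m)"
      unfolding pole_candidates_def e_def[symmetric] by blast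
    then show ?thesis
    proof cases
      case 2
      have "- real (e * m) \<le> real e" by linarith
      then show ?thesis unfolding 2 by (simp only: uminus_complex.sel complex_Re_of_nat)
    qed simp
  qed
  have eq: "K t - 1 / 2 = ?f t" if t: "t \<in> ?U" for t
  proof (rule analytic_continuation_open[where s = "{t. Re t > 2}" and s' = ?U
        and f = "\<lambda>t. K t - 1 / 2" and g = ?f])
    show "{t. Re t > 2} \<noteq> {}" by (auto intro!: exI[of _ 3])
    show "connected ?U" by (intro convex_connected convex_halfspace_Re_gt)
    show "{t. Re t > 2} \<subseteq> ?U" using e by auto
    have "?U \<subseteq> UNIV - pole_candidates x" using candidates by force
    then have "K holomorphic_on ?U"
      using K(2) analytic_imp_holomorphic analytic_on_subset by blast
    then show "(\<lambda>t. K t - 1 / 2) holomorphic_on ?U" by (intro holomorphic_intros)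
    show "K z - 1 / 2 = ?f z" if "z \<in> {t. Re t > 2}" for z
      using K(1)[of z] that by (simp add: K2_series_def K2_term_diagonal a_def)
  qed (use t series(2) open_halfspace_Re_gt in auto)
  have "\<not> K analytic_on {of_real (real e)}"
  proof (rule not_analytic_of_divergence[OF _ _ C(2)])
    show "a n \<ge> 0" for n by (simp add: a_def)
    fix t assume "t > real e"
    then have t: "complex_of_real t \<in> ?U" by simp
    show "(\<lambda>n. of_real (a n) * exp (- of_real t * harm (Suc n))) sums (K (of_real t) - 1 / 2)"
      unfolding eq[OF t] by (rule summable_sums) (use series(1) t in simp)
  qed
  then show ?thesis by simp
qed

lemma K2_continuation_diagonal:
  assumes x: "x \<in> {-1..1}"
  shows "\<exists>K. (\<forall>t. Re t > 2 \<longrightarrow> summable (\<lambda>n. K2_term t x x (Suc n)) \<and> K t = K2_series t x x) \<and>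
    K meromorphic_on UNIV \<and>
    has_simple_pole K (of_nat (1 + endpoint_delta x)) \<and>
    (\<forall>t. has_simple_pole K t \<or> K analytic_on {t}) \<and>
    K analytic_on (UNIV - pole_candidates x)"
proof -
  let ?P = "\<lambda>N. lattice_points (1 + endpoint_delta x) {0..<N + 3} - {0}"
  have x1: "\<bar>x\<bar> \<le> 1" using x by auto
  have Re: "Re s \<le> 2" if "s \<in> ?P N" for s N
    using that lattice_points_subset_candidates[of x "{0..<N + 3}"]
    by (auto simp: pole_candidates_def endpoint_delta_def split: if_splits)
  have fin: "finite (?P N)" for N by (simp add: finite_lattice_points)
  have mono: "?P M \<subseteq> ?P N" if "M \<le> N" for M N
    using that by (auto simp: lattice_points_def)
  obtain K where K: "\<And>t. Re t > 2 \<Longrightarrow> K t = K2_series t x x"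
    "\<And>t. has_simple_pole K t \<or> K analytic_on {t}" "K analytic_on UNIV - (\<Union>N. ?P N)"
  proof (rule K2_continuation[of ?P x x])
    show "?P M \<subseteq> ?P N" if "M \<le> N" for M N by (rule mono[OF that])
    show "Re s \<le> 2" if "s \<in> ?P N" for s N by (rule Re[OF that])
  qed (rule fin continues_K2_diagonal[OF x1] that; assumption?)+
  have an: "K analytic_on UNIV - pole_candidates x"
    by (rule analytic_on_subset[OF K(3)]) (use lattice_points_subset_candidates in blast)
  have "\<not> K analytic_on {of_nat (1 + endpoint_delta x)}"
    by (rule K2_diagonal_pole[OF x1 K(1) an])
  then have "has_simple_pole K (of_nat (1 + endpoint_delta x))" using K(2) by blast
  with K(1,2) an show ?thesis
    using continues_summable[OF continues_K2_diagonal[OF x1, of 0]] meromorphic_of_simple_poles[OF K(2)]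
    by (intro exI[of _ K] conjI allI impI) assumption+
qed

theorem theorem1p4:
  shows "\<exists>K :: complex \<Rightarrow> real \<Rightarrow> real \<Rightarrow> complex.
    (\<forall>x\<in>{-1..1}. \<forall>y\<in>{-1..1}. \<forall>t. Re t > 2 \<longrightarrow>
        summable (\<lambda>n. K2_term t x y (Suc n)) \<and> K t x y = K2_series t x y) \<and>
    (\<forall>x\<in>{-1..1}. \<forall>y\<in>{-1..1}. x \<noteq> y \<longrightarrow> (\<lambda>t. K t x y) holomorphic_on UNIV) \<and>
    (\<forall>x\<in>{-1..1}.
        (\<lambda>t. K t x x) meromorphic_on UNIV \<and>
        has_simple_pole (\<lambda>t. K t x x) (of_nat (1 + endpoint_delta x)) \<and>
        (\<forall>m::nat. m \<ge> 1 \<longrightarrow>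
            has_simple_pole (\<lambda>t. K t x x) (- of_nat ((1 + endpoint_delta x) * m)) \<or>
            (\<lambda>t. K t x x) analytic_on {- of_nat ((1 + endpoint_delta x) * m)}) \<and>
        (\<lambda>t. K t x x) analytic_on
          (UNIV - insert (of_nat (1 + endpoint_delta x))
                    {- of_nat ((1 + endpoint_delta x) * m) | m::nat. m \<ge> 1})) \<and>
    (\<forall>x\<in>{-1..1}. \<forall>y\<in>{-1..1}. (\<lambda>t. K t x y) analytic_on {0})"
proof -
  define good where "good x y K \<longleftrightarrow>
      (\<forall>t. Re t > 2 \<longrightarrow> summable (\<lambda>n. K2_term t x y (Suc n)) \<and> K t = K2_series t x y) \<and>
      (if x = y then K meromorphic_on UNIV \<and> has_simple_pole K (of_nat (1 + endpoint_delta x)) \<and>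
          (\<forall>t. has_simple_pole K t \<or> K analytic_on {t}) \<and> K analytic_on (UNIV - pole_candidates x)
       else K holomorphic_on UNIV)" for x y K
  \<comment> \<open>The continuations for different pairs are independent, so they are chosen pair by pair.\<close>
  have "\<exists>K. good x y K" if "x \<in> {-1..1}" "y \<in> {-1..1}" for x y
    using K2_continuation_offdiagonal[OF that] K2_continuation_diagonal[OF that(1)]
    unfolding good_def by (cases "x = y") auto
  then obtain K where K: "\<And>x y. x \<in> {-1..1} \<Longrightarrow> y \<in> {-1..1} \<Longrightarrow> good x y (K x y)"
    by metis
  have "0 \<notin> pole_candidates x" for x
    by (auto simp: pole_candidates_def simp del: of_nat_Suc of_nat_add of_nat_mult)
  then have sub: "{0} \<subseteq> (if x = y then UNIV - pole_candidates x else UNIV)" for x y by simp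
  have an: "K x y analytic_on (if x = y then UNIV - pole_candidates x else UNIV)"
    if "x \<in> {-1..1}" "y \<in> {-1..1}" for x y
    using K[OF that] by (auto simp: good_def analytic_on_open)
  have zero: "K x y analytic_on {0}" if "x \<in> {-1..1}" "y \<in> {-1..1}" for x y
    by (rule analytic_on_subset[OF an[OF that] sub])
  show ?thesis
  proof (intro exI[of _ "\<lambda>t x y. K x y t"] conjI)
    show "\<forall>x\<in>{-1..1}. \<forall>y\<in>{-1..1}. \<forall>t. Re t > 2 \<longrightarrow>
        summable (\<lambda>n. K2_term t x y (Suc n)) \<and> K x y t = K2_series t x y"
      using K by (simp add: good_def)
    show "\<forall>x\<in>{-1..1}. \<forall>y\<in>{-1..1}. x \<noteq> y \<longrightarrow> (\<lambda>t. K x y t) holomorphic_on UNIV"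
      using K by (simp add: good_def)
    show "\<forall>x\<in>{-1..1}.
        (\<lambda>t. K x x t) meromorphic_on UNIV \<and>
        has_simple_pole (\<lambda>t. K x x t) (of_nat (1 + endpoint_delta x)) \<and>
        (\<forall>m::nat. m \<ge> 1 \<longrightarrow>
            has_simple_pole (\<lambda>t. K x x t) (- of_nat ((1 + endpoint_delta x) * m)) \<or>
            (\<lambda>t. K x x t) analytic_on {- of_nat ((1 + endpoint_delta x) * m)}) \<and>
        (\<lambda>t. K x x t) analytic_on
          (UNIV - insert (of_nat (1 + endpoint_delta x))
                    {- of_nat ((1 + endpoint_delta x) * m) | m::nat. m \<ge> 1})"
      unfolding pole_candidates_def[symmetric]
    proof (intro ballI conjI allI impI)
      fix x :: real assume "x \<in> {-1..1}"
      from K[OF this this] show "(\<lambda>t. K x x t) meromorphic_on UNIV"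
        "has_simple_pole (\<lambda>t. K x x t) (of_nat (1 + endpoint_delta x))"
        "has_simple_pole (\<lambda>t. K x x t) s \<or> (\<lambda>t. K x x t) analytic_on {s}"
        "(\<lambda>t. K x x t) analytic_on (UNIV - pole_candidates x)" for s
        unfolding good_def by simp_all
    qed
    show "\<forall>x\<in>{-1..1}. \<forall>y\<in>{-1..1}. (\<lambda>t. K x y t) analytic_on {0}"
      using zero by simp
  qed
qed

end
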